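(* Let $\mathbb{F}$ be an arbitrary field and let $\mathcal{O}$ be an Okubo algebra over $\mathbb{F}$ that has nonzero idempotents or zero divisors. Then $l(\mathcal{O}) = 4$.
   Context: Algebras over $\mathbb{F}$ are vector spaces with a bilinear multiplication, not necessarily unital or associative. A nonzero idempotent is an element $c\neq 0$ with $c c=c$; a zero divisor is a nonzero element $a$ for which there is a nonzero $b$ with $ab=0$ or $ba=0$. Okubo algebras: let $\overline{\mathbb{F}}$ be an algebraic closure of $\mathbb{F}$. Let $\mathcal{S}$ be the $8$-dimensional algebra over $\overline{\mathbb{F}}$ with basis $x_{i,j}$, $i,j\in\{-1,0,1\}$, $(i,j)\ne(0,0)$, and the following multiplication. Write $\overline{x_{i,j}}=x_{-i,-j}$. For every basis element $u$, $u*u=-\overline{u}$. For each of the eight triples $(u,v,w)$: $(x_{1,0},x_{0,-1},x_{-1,1})$, $(x_{1,0},x_{-1,-1},x_{0,1})$, $(x_{1,0},x_{1,-1},x_{1,1})$, $(x_{-1,0},x_{0,1},x_{1,-1})$, $(x_{-1,0},x_{1,1},x_{0,-1})$, $(x_{-1,0},x_{-1,1},x_{-1,-1})$, $(x_{0,1},x_{1,1},x_{-1,1})$, $(x_{0,-1},x_{-1,-1},x_{1,-1})$, one has $u*v=\overline{w}$, $v*w=\overline{u}$, $w*u=\overline{v}$. All other products of basis elements are $0$. An Okubo algebra over $\mathbb{F}$ is an $\mathbb{F}$-algebra $\mathcal{O}$ with $\mathcal{O}\otimes_{\mathbb{F}}\overline{\mathbb{F}}\cong\mathcal{S}$. (If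 $\operatorname{char}\mathbb{F}\ne2,3$, then $\mathcal{S}$ is isomorphic to the pseudo-octonion algebra $P_8(\overline{\mathbb{F}})$: the space of trace zero $3\times3$ matrices with $x*y=\mu xy+(1-\mu)yx-\frac{\operatorname{tr}(xy)}{3}I$, where $3\mu(1-\mu)=1$.) Every Okubo algebra is $8$-dimensional and non-unital. Length: let $\mathcal{B}$ be a finite-dimensional algebra and $S\subseteq\mathcal{B}$. For $k\ge1$, a word of length $k$ in $S$ is any product of $k$ elements of $S$, with any arrangement of brackets; if $\mathcal{B}$ is unital, its unity is the word of length $0$, and if $\mathcal{B}$ is not unital there are no words of length $0$. $\mathcal{L}_k(S)$ is the linear span of all words of length at most $k$ in $S$ (so $\mathcal{L}_0(S)=\{0\}$ if $\mathcal{B}$ is non-unital), and $\mathcal{L}_\infty(S)=\bigcup_k\mathcal{L}_k(S)$. $S$ is generating if $\mathcal{L}_\infty(S)=\mathcal{B}$. $l(S)=\min\{k\ge 0:\mathcal{L}_k(S)=\mathcal{L}_\infty(S)\}$, and $l(\mathcal{B})=\max\{l(S): S \text{ generating for } \mathcal{B}\}$. *)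

theory Defs
  imports
    "HOL-Analysis.Finite_Cartesian_Product"
    "HOL-Analysis.Cartesian_Space"
    "HOL-Library.Poly_Mapping"
    "HOL-Algebra.Algebraic_Closure_Type"
begin

section \<open>The split algebra over a field\<close>

typedef okubo_index =
  "{(i, j). i \<in> {-1, 0, 1} \<and> j \<in> {-1, 0, 1} \<and> (i, j) \<noteq> (0, 0)} :: (int \<times> int) set"
  morphisms index_pair mk_index
  by (intro exI[of _ "(1, 0)"]) simp

instance okubo_index :: finite
proof
  have "({(i, j). i \<in> {-1, 0, 1} \<and> j \<in> {-1, 0, 1} \<and> (i, j) \<noteq> (0, 0)} :: (int \<times> int) set)
          \<subseteq> {-1, 0, 1} \<times> {-1, 0, 1}" by auto
  then have "finite (range index_pair)"
    unfolding type_definition.Rep_range[OF type_definition_okubo_index]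
    by (rule finite_subset) simp
  then show "finite (UNIV :: okubo_index set)"
    by (rule finite_imageD) (simp add: inj_on_def index_pair_inject)
qed

definition index_bar :: "int \<times> int \<Rightarrow> int \<times> int" where
  "index_bar p = (- fst p, - snd p)"

definition okubo_triples :: "((int \<times> int) \<times> (int \<times> int) \<times> (int \<times> int)) set" where
  "okubo_triples =
    {((1, 0), (0, -1), (-1, 1)),
     ((1, 0), (-1, -1), (0, 1)),
     ((1, 0), (1, -1), (1, 1)),
     ((-1, 0), (0, 1), (1, -1)),
     ((-1, 0), (1, 1), (0, -1)),
     ((-1, 0), (-1, 1), (-1, -1)),
     ((0, 1), (1, 1), (-1, 1)),
     ((0, -1), (-1, -1), (1, -1))}"

text \<open>The coefficient of \<open>x\<^sub>w\<close> in the product of the basis elements \<open>x\<^sub>u\<close> and \<open>x\<^sub>v\<close>. In the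
  second case, \<open>w\<close> is the bar of the third member of a cyclic rotation of one of the triples.\<close>

definition okubo_coeff :: "int \<times> int \<Rightarrow> int \<times> int \<Rightarrow> int \<times> int \<Rightarrow> 'k::field" where
  "okubo_coeff u v w =
    (if u = v \<and> w = index_bar u then -1
     else if (u, v, index_bar w) \<in> okubo_triples
        \<or> (v, index_bar w, u) \<in> okubo_triples
        \<or> (index_bar w, u, v) \<in> okubo_triples then 1
     else 0)"

text \<open>The underlying space is \<open>'k ^ okubo_index\<close>; its standard basis vectors \<open>axis i 1\<close> are
  the \<open>x\<^sub>i\<^sub>,\<^sub>j\<close>.\<close>

definition split_okubo_mult ::
    "'k::field ^ okubo_index \<Rightarrow> 'k ^ okubo_index \<Rightarrow> 'k ^ okubo_index" where
  "split_okubo_mult x y =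
    (\<chi> w. \<Sum>u\<in>UNIV. \<Sum>v\<in>UNIV.
       okubo_coeff (index_pair u) (index_pair v) (index_pair w) * (x $ u) * (y $ v))"


section \<open>Nonassociative algebras\<close>

locale nonassoc_algebra = vector_space scale
  for scale :: "'a::field \<Rightarrow> 'v::ab_group_add \<Rightarrow> 'v" (infixr \<open>\<bullet>\<close> 75) +
  fixes mult :: "'v \<Rightarrow> 'v \<Rightarrow> 'v" (infixl \<open>\<star>\<close> 70)
  assumes mult_add_left: "(x + y) \<star> z = x \<star> z + y \<star> z"
    and mult_add_right: "x \<star> (y + z) = x \<star> y + x \<star> z"
    and mult_scale_left: "(a \<bullet> x) \<star> y = a \<bullet> (x \<star> y)"
    and mult_scale_right: "x \<star> (a \<bullet> y) = a \<bullet> (x \<star> y)"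
begin

definition has_nonzero_idempotent :: bool where
  "has_nonzero_idempotent \<longleftrightarrow> (\<exists>c. c \<noteq> 0 \<and> c \<star> c = c)"

definition zero_divisor :: "'v \<Rightarrow> bool" where
  "zero_divisor a \<longleftrightarrow> a \<noteq> 0 \<and> (\<exists>b. b \<noteq> 0 \<and> (a \<star> b = 0 \<or> b \<star> a = 0))"

definition has_zero_divisor :: bool where
  "has_zero_divisor \<longleftrightarrow> (\<exists>a. zero_divisor a)"


subsection \<open>Length\<close>

inductive bracketed_word :: "'v set \<Rightarrow> nat \<Rightarrow> 'v \<Rightarrow> bool" for S where
  letter: "x \<in> S \<Longrightarrow> bracketed_word S 1 x"
| product: "bracketed_word S m x \<Longrightarrow> bracketed_word S n y \<Longrightarrow> bracketed_word S (m + n) (x \<star> y)"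

definition words :: "'v set \<Rightarrow> nat \<Rightarrow> 'v set" where
  "words S k = (if k = 0 then {e. \<forall>x. e \<star> x = x \<and> x \<star> e = x} else {x. bracketed_word S k x})"

definition word_span :: "'v set \<Rightarrow> nat \<Rightarrow> 'v set" where
  "word_span S k = span (\<Union>j\<le>k. words S j)"

definition word_span_all :: "'v set \<Rightarrow> 'v set" where
  "word_span_all S = (\<Union>k. word_span S k)"

definition generating :: "'v set \<Rightarrow> bool" where
  "generating S \<longleftrightarrow> word_span_all S = UNIV"

text \<open>The minimum and the maximum below exist when the algebra is finite-dimensional.\<close>

definition set_length :: "'v set \<Rightarrow> nat" where
  "set_length S = (LEAST k. word_span S k = word_span_all S)"

definition algebra_length :: nat where
  "algebra_length = Max {set_length S | S. generating S}"


subsection \<open>Extension of scalars to the algebraic closure\<close>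

text \<open>The tensor product with the algebraic closure is the free abelian group on pairs \<open>(v, c)\<close>,
  divided by the subgroup generated by the usual relations. Since that subgroup depends on
  \<open>scale\<close>, the quotient is a set of classes and not a type.\<close>

inductive_set tensor_null :: "('v \<times> 'a alg_closure \<Rightarrow>\<^sub>0 int) set" where
  add_left: "frag_of (v + w, c) - frag_of (v, c) - frag_of (w, c) \<in> tensor_null"
| add_right: "frag_of (v, c + d) - frag_of (v, c) - frag_of (v, d) \<in> tensor_null"
| balanced: "frag_of (a \<bullet> v, c) - frag_of (v, to_ac a * c) \<in> tensor_null"
| diff: "x \<in> tensor_null \<Longrightarrow> y \<in> tensor_null \<Longrightarrow> x - y \<in> tensor_null"

definition tensor_rel :: "(('v \<times> 'a alg_closure \<Rightarrow>\<^sub>0 int) \<times> ('v \<times> 'a alg_closure \<Rightarrow>\<^sub>0 int)) set" where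
  "tensor_rel = {(x, y). x - y \<in> tensor_null}"

definition tensor_space :: "('v \<times> 'a alg_closure \<Rightarrow>\<^sub>0 int) set set" where
  "tensor_space = UNIV // tensor_rel"

definition free_scale ::
    "'a alg_closure \<Rightarrow> ('v \<times> 'a alg_closure \<Rightarrow>\<^sub>0 int) \<Rightarrow> ('v \<times> 'a alg_closure \<Rightarrow>\<^sub>0 int)" where
  "free_scale k = frag_extend (\<lambda>(v, c). frag_of (v, k * c))"

definition free_mult ::
    "('v \<times> 'a alg_closure \<Rightarrow>\<^sub>0 int) \<Rightarrow> ('v \<times> 'a alg_closure \<Rightarrow>\<^sub>0 int) \<Rightarrow> ('v \<times> 'a alg_closure \<Rightarrow>\<^sub>0 int)" where
  "free_mult x y =
    frag_extend (\<lambda>(v, c). frag_extend (\<lambda>(w, d). frag_of (v \<star> w, c * d)) y) x"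

definition tensor_add where
  "tensor_add A B = (\<Union>x\<in>A. \<Union>y\<in>B. tensor_rel `` {x + y})"

definition tensor_scale where
  "tensor_scale k A = (\<Union>x\<in>A. tensor_rel `` {free_scale k x})"

definition tensor_mult where
  "tensor_mult A B = (\<Union>x\<in>A. \<Union>y\<in>B. tensor_rel `` {free_mult x y})"

lemma frag_induct [case_names zero one diff]:
  assumes "P 0" "\<And>p. P (frag_of p)" "\<And>a b. P a \<Longrightarrow> P b \<Longrightarrow> P (a - b)"
  shows "P x"
  using frag_induction[OF subset_UNIV] assms by metis

lemma tensor_null_zero: "0 \<in> tensor_null"
  using tensor_null.diff[OF tensor_null.add_left tensor_null.add_left] by (metis diff_self)

lemma tensor_null_minus: "x \<in> tensor_null \<Longrightarrow> - x \<in> tensor_null"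
  using tensor_null.diff[OF tensor_null_zero] by (metis diff_0)

lemma tensor_null_add: "x \<in> tensor_null \<Longrightarrow> y \<in> tensor_null \<Longrightarrow> x + y \<in> tensor_null"
  using tensor_null.diff[OF _ tensor_null_minus] by (metis diff_minus_eq_add)

lemma equiv_tensor_rel: "equiv UNIV tensor_rel"
proof (rule equivI)
  show "refl tensor_rel" by (auto simp: refl_on_def tensor_rel_def tensor_null_zero)
  show "sym tensor_rel"
  proof (rule symI)
    fix x y assume "(x, y) \<in> tensor_rel"
    then have "- (x - y) \<in> tensor_null"
      by (intro tensor_null_minus) (simp add: tensor_rel_def)
    then show "(y, x) \<in> tensor_rel" by (simp add: tensor_rel_def)
  qed
  show "trans tensor_rel"
  proof (rule transI)
    fix x y z assume "(x, y) \<in> tensor_rel" "(y, z) \<in> tensor_rel"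
    then have "(x - y) + (y - z) \<in> tensor_null"
      by (intro tensor_null_add) (simp_all add: tensor_rel_def)
    then show "(x, z) \<in> tensor_rel" by (simp add: tensor_rel_def)
  qed
qed simp

lemma free_scale_null: "x \<in> tensor_null \<Longrightarrow> free_scale k x \<in> tensor_null"
proof (induction rule: tensor_null.induct)
  case (balanced a v c)
  show ?case
    using tensor_null.balanced[of a v "k * c"]
    by (simp add: free_scale_def frag_extend_diff mult.left_commute)
qed (auto simp: free_scale_def frag_extend_diff distrib_left intro: tensor_null.intros)

lemma free_mult_diff_left: "free_mult (x - y) z = free_mult x z - free_mult y z"
  by (simp add: free_mult_def frag_extend_diff)

lemma free_mult_diff_right: "free_mult x (y - z) = free_mult x y - free_mult x z"
proof (induction x rule: frag_induct)
  case zero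
  show ?case by (simp add: free_mult_def)
next
  case (one p)
  show ?case by (cases p) (simp add: free_mult_def frag_extend_diff)
next
  case (diff a b)
  then show ?case by (simp add: free_mult_diff_left)
qed

lemma free_mult_of: "free_mult (frag_of (v, c)) (frag_of (w, d)) = frag_of (v \<star> w, c * d)"
  by (simp add: free_mult_def)

lemma free_mult_zero: "free_mult 0 y = 0" "free_mult x 0 = 0"
  using free_mult_diff_left[of 0 0 y] free_mult_diff_right[of x 0 0] by simp_all

lemma free_mult_null_left: "x \<in> tensor_null \<Longrightarrow> free_mult x y \<in> tensor_null"
proof (induction arbitrary: y rule: tensor_null.induct)
  case (add_left v w c)
  show ?case
  proof (induction y rule: frag_induct)
    case (one p) then show ?case
      by (cases p) (auto simp: free_mult_diff_left free_mult_of mult_add_left intro: tensor_null.intros)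
  qed (auto simp: free_mult_zero tensor_null_zero free_mult_diff_right intro: tensor_null.diff)
next
  case (add_right v c d)
  show ?case
  proof (induction y rule: frag_induct)
    case (one p) then show ?case
      by (cases p) (auto simp: free_mult_diff_left free_mult_of distrib_right intro: tensor_null.intros)
  qed (auto simp: free_mult_zero tensor_null_zero free_mult_diff_right intro: tensor_null.diff)
next
  case (balanced a v c)
  show ?case
  proof (induction y rule: frag_induct)
    case (one p) then show ?case
      by (cases p) (auto simp: free_mult_diff_left free_mult_of mult_scale_left mult.assoc
          intro: tensor_null.intros)
  qed (auto simp: free_mult_zero tensor_null_zero free_mult_diff_right intro: tensor_null.diff)
qed (auto simp: free_mult_diff_left intro: tensor_null.diff)

lemma free_mult_null_right: "y \<in> tensor_null \<Longrightarrow> free_mult x y \<in> tensor_null"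
proof (induction arbitrary: x rule: tensor_null.induct)
  case (add_left v w c)
  show ?case
  proof (induction x rule: frag_induct)
    case (one p) then show ?case
      by (cases p) (auto simp: free_mult_diff_right free_mult_of mult_add_right intro: tensor_null.intros)
  qed (auto simp: free_mult_zero tensor_null_zero free_mult_diff_left intro: tensor_null.diff)
next
  case (add_right v c d)
  show ?case
  proof (induction x rule: frag_induct)
    case (one p) then show ?case
      by (cases p) (auto simp: free_mult_diff_right free_mult_of distrib_left intro: tensor_null.intros)
  qed (auto simp: free_mult_zero tensor_null_zero free_mult_diff_left intro: tensor_null.diff)
next
  case (balanced a v c)
  show ?case
  proof (induction x rule: frag_induct)
    case (one p)
    obtain u b where "p = (u, b)" by (cases p)
    then show ?case
      using tensor_null.balanced[of a "u \<star> v" "b * c"]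
      by (simp add: free_mult_diff_right free_mult_of mult_scale_right mult.left_commute)
  qed (auto simp: free_mult_zero tensor_null_zero free_mult_diff_left intro: tensor_null.diff)
qed (auto simp: free_mult_diff_right intro: tensor_null.diff)

lemma tensor_add_class:
  "tensor_add (tensor_rel `` {x}) (tensor_rel `` {y}) = tensor_rel `` {x + y}"
  unfolding tensor_add_def
proof (rule UN_equiv_class2[OF equiv_tensor_rel equiv_tensor_rel])
  show "congruent2 tensor_rel tensor_rel (\<lambda>x y. tensor_rel `` {x + y})"
  proof (rule congruent2I', rule equiv_class_eq[OF equiv_tensor_rel])
    fix x x' y y' assume "(x, x') \<in> tensor_rel" "(y, y') \<in> tensor_rel"
    then show "(x + y, x' + y') \<in> tensor_rel"
      using tensor_null_add[of "x - x'" "y - y'"] by (simp add: tensor_rel_def algebra_simps)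
  qed
qed auto

lemma tensor_scale_class:
  "tensor_scale k (tensor_rel `` {x}) = tensor_rel `` {free_scale k x}"
  unfolding tensor_scale_def
proof (rule UN_equiv_class[OF equiv_tensor_rel])
  show "congruent tensor_rel (\<lambda>x. tensor_rel `` {free_scale k x})"
  proof (rule congruentI, rule equiv_class_eq[OF equiv_tensor_rel])
    fix x y assume "(x, y) \<in> tensor_rel"
    then show "(free_scale k x, free_scale k y) \<in> tensor_rel"
      using free_scale_null[of "x - y" k]
      by (simp add: tensor_rel_def free_scale_def frag_extend_diff)
  qed
qed auto

lemma tensor_mult_class:
  "tensor_mult (tensor_rel `` {x}) (tensor_rel `` {y}) = tensor_rel `` {free_mult x y}"
  unfolding tensor_mult_def
proof (rule UN_equiv_class2[OF equiv_tensor_rel equiv_tensor_rel])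
  show "congruent2 tensor_rel tensor_rel (\<lambda>x y. tensor_rel `` {free_mult x y})"
  proof (rule congruent2I', rule equiv_class_eq[OF equiv_tensor_rel])
    fix x x' y y' assume "(x, x') \<in> tensor_rel" "(y, y') \<in> tensor_rel"
    then have "free_mult (x - x') y + free_mult x' (y - y') \<in> tensor_null"
      by (intro tensor_null_add free_mult_null_left free_mult_null_right)
         (simp_all add: tensor_rel_def)
    then show "(free_mult x y, free_mult x' y') \<in> tensor_rel"
      by (simp add: tensor_rel_def free_mult_diff_left free_mult_diff_right)
  qed
qed auto

end


section \<open>Okubo algebras\<close>

locale okubo_algebra = nonassoc_algebra scale mult
  for scale :: "'a::field \<Rightarrow> 'v::ab_group_add \<Rightarrow> 'v" and mult :: "'v \<Rightarrow> 'v \<Rightarrow> 'v" +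
  assumes extension_iso_split:
    "\<exists>\<phi> :: ('v \<times> 'a alg_closure \<Rightarrow>\<^sub>0 int) set \<Rightarrow> 'a alg_closure ^ okubo_index.
       bij_betw \<phi> tensor_space UNIV
     \<and> (\<forall>A\<in>tensor_space. \<forall>B\<in>tensor_space. \<phi> (tensor_add A B) = \<phi> A + \<phi> B)
     \<and> (\<forall>k. \<forall>A\<in>tensor_space. \<phi> (tensor_scale k A) = k *s \<phi> A)
     \<and> (\<forall>A\<in>tensor_space. \<forall>B\<in>tensor_space.
          \<phi> (tensor_mult A B) = split_okubo_mult (\<phi> A) (\<phi> B))"

end

theory Submission
  imports Defs
begin

text \<open>
  An Okubo algebra inherits from the split algebra a quadratic form \<open>n\<close> with
  \<open>(x \<star> y) \<star> x = n x \<cdot> y = x \<star> (y \<star> x)\<close>: it is a symmetric composition algebra. Besides this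
  identity, the proof uses three facts about it: the dimension is eight, the polar form of \<open>n\<close> is
  nondegenerate, and only \<open>0\<close> commutes with every element. All of them descend from the split
  algebra over the algebraic closure, where they are read off from coordinates
  (\<open>split_extension.eight_dim\<close>).

  The bound \<open>l(S) \<le> 4\<close> compares the dimensions \<open>d\<^sub>k\<close> of the spans of words of length at most
  \<open>k\<close>. Polarising the identity gives \<open>(x \<star> y) \<star> z \<equiv> - ((z \<star> y) \<star> x)\<close> and
  \<open>x \<star> (y \<star> z) \<equiv> - (z \<star> (y \<star> x))\<close> modulo shorter words. Hence every word is, modulo
  shorter ones, a combination of products of a letter and a word, and the filtration stops for
  good as soon as it stops once. The same two congruences show that it stops after an increment
  of at most one from length \<open>1\<close> to \<open>2\<close> (\<open>length_three_stable\<close>) or from \<open>2\<close> to \<open>3\<close>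
  (\<open>length_four_stable\<close>), and for two letters also from \<open>3\<close> to \<open>4\<close>
  (\<open>length_five_stable_two_letters\<close>). If words of length five were still needed to reach
  the whole algebra, then \<open>d\<^sub>1 \<ge> 2\<close>, the next two increments would be at least two and the
  following two at least one. As \<open>d\<^sub>5 \<le> 8\<close>, this forces the increments \<open>2, 2, 2, 1, 1\<close>, which
  the statement about two letters excludes.

  The value \<open>4\<close> is attained by two letters that satisfy an additional relation, so that words of
  length at most three span at most seven dimensions. One of them may be an idempotent:
  \<open>e \<star> e = e\<close> turns \<open>e \<star> (e \<star> b)\<close> and \<open>(b \<star> e) \<star> e\<close> into combinations of shorter words. Or
  the letters satisfy \<open>a \<star> b = 0\<close> and \<open>polar a b = 0\<close>. What has to be shown is that such letters
  can be chosen to generate the algebra.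

  If \<open>n\<close> is isotropic, put \<open>cubic x = polar x (x \<star> x)\<close>. There are isotropic \<open>a\<close>, \<open>b\<close> with
  \<open>a \<star> b = 0\<close>, \<open>polar a b = 0\<close> and nonzero \<open>cubic a\<close>, \<open>cubic b\<close> (\<open>cubic_pair\<close>). In the split
  algebra \<open>a = x\<^sub>1\<^sub>,\<^sub>0\<close> and \<open>b = x\<^sub>0\<^sub>,\<^sub>1\<close> are such a pair. Eight products of \<open>a\<close> and \<open>b\<close>
  fall into four hyperbolic pairs and are therefore a basis. To find \<open>b\<close>, one studies
  \<open>x \<mapsto> x \<star> a\<close> on the space of all \<open>x\<close> with \<open>a \<star> x = 0\<close> and \<open>polar a x = 0\<close>; if it were a
  scalar there, a nonzero element would commute with everything. Characteristic three, where
  \<open>cubic\<close> is additive, needs an argument of its own, in which \<open>a\<close> may have to be replaced.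

  If \<open>n\<close> is anisotropic, there are no zero divisors, so by hypothesis there is an idempotent \<open>e\<close>. A
  proper subalgebra \<open>B\<close> has dimension at most four, because \<open>B\<close> and \<open>B \<star> v\<close> meet only in \<open>0\<close> for
  \<open>v \<notin> B\<close>. So it suffices to find \<open>b\<close> such that \<open>e\<close> and \<open>b\<close> generate five independent
  elements. The cube of the map \<open>x \<mapsto> e \<star> (e \<star> x)\<close> is the identity, and \<open>b = c + d\<close> works for a suitable
  fixed vector \<open>c\<close> and a suitable \<open>d\<close> in the image of its difference with the identity.
\<close>

section \<open>Symmetric composition algebras\<close>

locale symmetric_composition = nonassoc_algebra scale mult
  for scale :: "'a::field \<Rightarrow> 'v::ab_group_add \<Rightarrow> 'v" (infixr \<open>\<cdot>\<close> 75)
    and mult :: "'v \<Rightarrow> 'v \<Rightarrow> 'v" (infixl \<open>\<star>\<close> 70) +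
  fixes n :: "'v \<Rightarrow> 'a"
  assumes comp_left: "(x \<star> y) \<star> x = n x \<cdot> y"
    and comp_right: "x \<star> (y \<star> x) = n x \<cdot> y"
    and dim_ge_two: "\<exists>y. y \<notin> span {x}"
begin

definition polar :: "'v \<Rightarrow> 'v \<Rightarrow> 'a" where
  "polar x z = n (x + z) - n x - n z"

definition cubic :: "'v \<Rightarrow> 'a" where
  "cubic x = polar x (x \<star> x)"

lemma mult_zero_left [simp]: "0 \<star> x = 0"
  using mult_add_left[of 0 0 x] by simp

lemma mult_zero_right [simp]: "x \<star> 0 = 0"
  using mult_add_right[of x 0 0] by simp

lemma mult_minus_left: "(- x) \<star> y = - (x \<star> y)"
  using mult_add_left[of x "- x" y] by (simp add: eq_neg_iff_add_eq_0 add.commute)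

lemma mult_minus_right: "x \<star> (- y) = - (x \<star> y)"
  using mult_add_right[of x y "- y"] by (simp add: eq_neg_iff_add_eq_0 add.commute)

lemma mult_diff_left: "(x - y) \<star> z = x \<star> z - y \<star> z"
  using mult_add_left[of x "- y" z] by (simp add: mult_minus_left)

lemma mult_diff_right: "x \<star> (y - z) = x \<star> y - x \<star> z"
  using mult_add_right[of x y "- z"] by (simp add: mult_minus_right)

lemmas mult_linear =
  mult_add_left mult_add_right mult_minus_left mult_minus_right mult_diff_left mult_diff_right
  mult_scale_left mult_scale_right

text \<open>The polarised composition identity. Both swap rules are used to move a letter from one end of
  a product to the other at the price of a shorter term.\<close>

lemma swap_left: "(x \<star> y) \<star> z = polar x z \<cdot> y - (z \<star> y) \<star> x"
proof -
  have "((x + z) \<star> y) \<star> (x + z) = n (x + z) \<cdot> y" by (rule comp_left)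
  then have "n x \<cdot> y + n z \<cdot> y + (x \<star> y) \<star> z + (z \<star> y) \<star> x = n (x + z) \<cdot> y"
    by (simp add: mult_linear comp_left algebra_simps)
  then show ?thesis
    by (simp add: polar_def scale_left_diff_distrib algebra_simps)
qed

lemma swap_right: "x \<star> (y \<star> z) = polar x z \<cdot> y - z \<star> (y \<star> x)"
proof -
  have "(x + z) \<star> (y \<star> (x + z)) = n (x + z) \<cdot> y" by (rule comp_right)
  then have "n x \<cdot> y + n z \<cdot> y + x \<star> (y \<star> z) + z \<star> (y \<star> x) = n (x + z) \<cdot> y"
    by (simp add: mult_linear comp_right algebra_simps)
  then show ?thesis
    by (simp add: polar_def scale_left_diff_distrib algebra_simps)
qed

lemma exists_nonzero: "\<exists>y::'v. y \<noteq> 0"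
  using dim_ge_two[of 0] by (auto simp: span_singleton)

lemma n_zero [simp]: "n 0 = 0"
  using comp_left[of 0] exists_nonzero by auto

lemma n_scale: "n (k \<cdot> x) = k\<^sup>2 * n x"
proof -
  obtain y :: 'v where "y \<noteq> 0" using exists_nonzero by auto
  have "n (k \<cdot> x) \<cdot> y = ((k \<cdot> x) \<star> y) \<star> (k \<cdot> x)" by (rule comp_left[symmetric])
  also have "\<dots> = (k\<^sup>2 * n x) \<cdot> y"
    by (simp add: mult_linear comp_left power2_eq_square mult.assoc)
  finally show ?thesis using \<open>y \<noteq> 0\<close> by simp
qed

lemma n_minus [simp]: "n (- x) = n x"
  using n_scale[of "- 1" x] by simp

text \<open>Evaluate \<open>(x \<star> y) \<star> (y \<star> (x \<star> y))\<close> in two ways: with \<open>x \<star> y\<close> as the outer factor it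
  is \<open>n (x \<star> y) \<cdot> y\<close>, and with the inner product evaluated first it is \<open>n y \<cdot> n x \<cdot> y\<close>.\<close>

lemma n_mult: "n (x \<star> y) = n x * n y"
proof (cases "y = 0")
  case False
  have "n (x \<star> y) \<cdot> y = (x \<star> y) \<star> (y \<star> (x \<star> y))" by (rule comp_right[symmetric])
  also have "\<dots> = (n x * n y) \<cdot> y" by (simp add: comp_right comp_left mult_linear mult.commute)
  finally show ?thesis using False by simp
qed simp

lemma polar_commute: "polar x y = polar y x"
  by (simp add: polar_def add.commute)

lemma polar_scale_eq: "polar x z \<cdot> y = (x \<star> y) \<star> z + (z \<star> y) \<star> x"
  by (subst swap_left) simp

lemma polar_add_left: "polar (x + x') z = polar x z + polar x' z"
proof -
  obtain y :: 'v where "y \<noteq> 0" using exists_nonzero by auto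
  moreover have "polar (x + x') z \<cdot> y = (polar x z + polar x' z) \<cdot> y"
    unfolding scale_left_distrib polar_scale_eq by (simp add: mult_linear algebra_simps)
  ultimately show ?thesis by simp
qed

lemma polar_scale_left: "polar (k \<cdot> x) z = k * polar x z"
proof -
  obtain y :: 'v where "y \<noteq> 0" using exists_nonzero by auto
  moreover have "polar (k \<cdot> x) z \<cdot> y = (k * polar x z) \<cdot> y"
    unfolding scale_scale[symmetric] polar_scale_eq by (simp add: mult_linear algebra_simps)
  ultimately show ?thesis by simp
qed

lemma polar_add_right: "polar z (x + x') = polar z x + polar z x'"
  by (metis polar_add_left polar_commute)

lemma polar_scale_right: "polar z (k \<cdot> x) = k * polar z x"
  by (metis polar_scale_left polar_commute)

lemma polar_minus_left: "polar (- x) z = - polar x z"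
  using polar_scale_left[of "- 1" x z] by simp

lemma polar_minus_right: "polar z (- x) = - polar z x"
  using polar_scale_right[of z "- 1" x] by simp

lemma polar_diff_left: "polar (x - x') z = polar x z - polar x' z"
  using polar_add_left[of x "- x'" z] by (simp add: polar_minus_left)

lemma polar_diff_right: "polar z (x - x') = polar z x - polar z x'"
  using polar_add_right[of z x "- x'"] by (simp add: polar_minus_right)

lemma polar_zero [simp]: "polar 0 z = 0" "polar z 0 = 0"
  by (simp_all add: polar_def)

lemmas polar_linear = polar_add_left polar_add_right polar_minus_left polar_minus_right
  polar_diff_left polar_diff_right polar_scale_left polar_scale_right

lemma polar_self: "polar x x = 2 * n x"
proof -
  have "x + x = 2 \<cdot> x" using scale_left_distrib[of 1 1 x] by simp
  then show ?thesis by (simp add: polar_def n_scale power2_eq_square)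
qed

lemma n_add: "n (x + y) = n x + n y + polar x y"
  by (simp add: polar_def)

lemma n_diff: "n (x - y) = n x + n y - polar x y"
  using n_add[of x "- y"] by (simp add: polar_minus_right)

text \<open>Expand \<open>polar (x \<star> y) z \<cdot> x\<close> and \<open>polar x (y \<star> z) \<cdot> x\<close> by the swap rules. Both expansions
  contain \<open>(x \<star> y) \<star> (x \<star> z)\<close>, \<open>(x \<star> x) \<star> (y \<star> z)\<close> and \<open>polar x y \<cdot> (z \<star> x)\<close>, and what remains is a
  multiple of \<open>y\<close>.\<close>

lemma polar_assoc_aux:
  "polar (x \<star> y) z \<cdot> x - polar x (y \<star> z) \<cdot> x = (polar (x \<star> z) x - polar z (x \<star> x)) \<cdot> y"
proof -
  have 1: "polar (x \<star> y) z \<cdot> x = (x \<star> y) \<star> (x \<star> z) + z \<star> (x \<star> (x \<star> y))"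
    by (subst swap_right[of "x \<star> y" x z]) simp
  have 2: "x \<star> (x \<star> y) = polar x y \<cdot> x - y \<star> (x \<star> x)" by (rule swap_right)
  have 3: "z \<star> (y \<star> (x \<star> x)) = polar z (x \<star> x) \<cdot> y - (x \<star> x) \<star> (y \<star> z)" by (rule swap_right)
  have 4: "polar x (y \<star> z) \<cdot> x = (x \<star> x) \<star> (y \<star> z) + ((y \<star> z) \<star> x) \<star> x"
    by (rule polar_scale_eq)
  have 5: "(y \<star> z) \<star> x = polar y x \<cdot> z - (x \<star> z) \<star> y" by (rule swap_left)
  have 6: "((x \<star> z) \<star> y) \<star> x = polar (x \<star> z) x \<cdot> y - (x \<star> y) \<star> (x \<star> z)" by (rule swap_left)
  show ?thesis
    unfolding 1 4 unfolding 2 5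
    by (simp add: mult_linear 3 6 polar_commute[of y x] scale_left_diff_distrib)
qed

text \<open>If \<open>y\<close> is not a multiple of \<open>x\<close>, both sides of the previous identity vanish. This gives the
  claim for such \<open>y\<close>, and it also gives \<open>polar (x \<star> z) x = polar z (x \<star> x)\<close>, which is the claim
  for the multiples of \<open>x\<close>. An element outside the line of \<open>x\<close> exists in dimension at least two.\<close>

lemma polar_assoc: "polar (x \<star> y) z = polar x (y \<star> z)"
proof (cases "x = 0")
  case x: False
  have *: "polar (x \<star> y) z = polar x (y \<star> z) \<and> polar (x \<star> z) x = polar z (x \<star> x)"
    if y: "y \<notin> span {x}" for y z
  proof -
    define p q where "p = polar (x \<star> y) z - polar x (y \<star> z)"
      and "q = polar (x \<star> z) x - polar z (x \<star> x)"
    have "p \<cdot> x = q \<cdot> y"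
      using polar_assoc_aux[of x y z] by (simp add: p_def q_def scale_left_diff_distrib)
    moreover have "q = 0"
    proof (rule ccontr)
      assume "q \<noteq> 0"
      then have "y = (p / q) \<cdot> x"
        using \<open>p \<cdot> x = q \<cdot> y\<close> by (metis divide_inverse_commute scale_scale scale_left_imp_eq
            nonzero_mult_div_cancel_left times_divide_eq_right)
      then show False using y by (simp add: span_scale span_base)
    qed
    ultimately show ?thesis using x by (simp add: p_def q_def)
  qed
  obtain y0 where "y0 \<notin> span {x}" using dim_ge_two by blast
  show ?thesis
  proof (cases "y \<in> span {x}")
    case True
    then obtain k where "y = k \<cdot> x" by (auto simp: span_singleton)
    then show ?thesis
      using *[OF \<open>y0 \<notin> span {x}\<close>, of z]
      by (simp add: mult_linear polar_linear polar_commute)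
  qed (use * in blast)
qed simp

lemma polar_rotate: "polar (x \<star> y) z = polar y (z \<star> x)"
  by (metis polar_assoc polar_commute)

lemma square_square: "(x \<star> x) \<star> (x \<star> x) = cubic x \<cdot> x - n x \<cdot> (x \<star> x)"
  unfolding cubic_def by (subst swap_left) (simp add: comp_left mult_linear)

text \<open>Associativity of the polar form identifies the three mixed terms of each degree. In
  characteristic three the form is therefore additive.\<close>

lemma cubic_add:
  "cubic (x + y) = cubic x + cubic y + 3 * polar (x \<star> x) y + 3 * polar x (y \<star> y)"
proof -
  have 1: "polar x (x \<star> y) = polar (x \<star> x) y" by (simp add: polar_assoc)
  have 2: "polar x (y \<star> x) = polar (x \<star> x) y"
    by (metis polar_assoc polar_commute)
  have 3: "polar y (x \<star> y) = polar x (y \<star> y)" by (metis polar_assoc polar_commute)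
  have 4: "polar y (y \<star> x) = polar x (y \<star> y)" by (metis polar_assoc polar_commute)
  show ?thesis
    by (simp add: cubic_def mult_linear polar_linear 1 2 3 4 polar_commute[of y "x \<star> x"])
qed

lemma cubic_scale: "cubic (k \<cdot> x) = k ^ 3 * cubic x"
  by (simp add: cubic_def mult_linear polar_linear power3_eq_cube)

lemma opposite: "symmetric_composition scale (\<lambda>x y. y \<star> x) n"
  by unfold_locales (simp_all add: mult_linear comp_left comp_right dim_ge_two)

end

section \<open>The filtration by word length\<close>

context nonassoc_algebra
begin

lemma bracketed_word_pos: "bracketed_word S k x \<Longrightarrow> 0 < k"
  by (induction rule: bracketed_word.induct) auto

lemma bracketed_word_one:
  assumes "bracketed_word S 1 x"
  shows "x \<in> S"
  using assms
proof (cases rule: bracketed_word.cases)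
  case (product p u q v)
  then show ?thesis using bracketed_word_pos[of S p u] bracketed_word_pos[of S q v] by simp
qed

lemma word_span_mono: "i \<le> j \<Longrightarrow> word_span S i \<subseteq> word_span S j"
  unfolding word_span_def by (intro span_mono) (auto intro: order_trans)

lemma subspace_word_span: "subspace (word_span S k)"
  unfolding word_span_def by (rule subspace_span)

lemma word_in_word_span: "bracketed_word S j x \<Longrightarrow> j \<le> k \<Longrightarrow> x \<in> word_span S k"
  unfolding word_span_def using bracketed_word_pos[of S j x]
  by (intro span_base) (auto simp: words_def intro!: exI[of _ j])

lemma letter_in_word_span: "x \<in> S \<Longrightarrow> 1 \<le> k \<Longrightarrow> x \<in> word_span S k"
  by (rule word_in_word_span[OF bracketed_word.letter])

lemma word_span_le_set_length:
  assumes "word_span S k = word_span_all S"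
  shows "set_length S \<le> k"
  unfolding set_length_def by (rule Least_le) (rule assms)

end

text \<open>Without a unit there are no words of length zero.\<close>

locale nonunital_algebra = nonassoc_algebra scale mult
  for scale :: "'a::field \<Rightarrow> 'v::ab_group_add \<Rightarrow> 'v" (infixr \<open>\<cdot>\<close> 75)
    and mult :: "'v \<Rightarrow> 'v \<Rightarrow> 'v" (infixl \<open>\<star>\<close> 70) +
  assumes no_unit: "\<not> (\<forall>x. e \<star> x = x \<and> x \<star> e = x)"
begin

lemma words_zero: "words S 0 = {}"
  using no_unit by (simp add: words_def)

lemma words_pos: "words S k = {x. bracketed_word S k x}"
  using bracketed_word_pos[of S k] words_zero by (auto simp: words_def split: if_splits)

lemma word_span_leI:
  assumes "subspace B" "\<And>j x. bracketed_word S j x \<Longrightarrow> j \<le> k \<Longrightarrow> x \<in> B"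
  shows "word_span S k \<subseteq> B"
  unfolding word_span_def using assms
  by (intro span_minimal) (auto simp: words_pos)

lemma word_span_one: "word_span S 1 = span S"
proof
  show "word_span S 1 \<subseteq> span S"
  proof (rule word_span_leI)
    fix j x assume "bracketed_word S j x" "j \<le> 1"
    moreover from this have "j = 1" using bracketed_word_pos[of S j x] by simp
    ultimately show "x \<in> span S" using bracketed_word_one span_base by blast
  qed simp
  show "span S \<subseteq> word_span S 1"
    by (intro span_minimal subspace_word_span) (auto intro: letter_in_word_span)
qed

lemma mult_zero_right': "x \<star> 0 = 0"
  using mult_add_right[of x 0 0] by simp

lemma mult_zero_left': "0 \<star> x = 0"
  using mult_add_left[of 0 0 x] by simp

lemma mult_mem_subspace_right:
  assumes "subspace B" "\<And>x. x \<in> M \<Longrightarrow> u \<star> x \<in> B" "y \<in> span M"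
  shows "u \<star> y \<in> B"
  using assms(3)
  by (induction rule: span_induct_alt)
     (use assms(1,2) in \<open>auto simp: mult_add_right mult_scale_right mult_zero_right' subspace_0
        intro!: subspace_add subspace_scale\<close>)

lemma mult_mem_subspace_left:
  assumes "subspace B" "\<And>x. x \<in> M \<Longrightarrow> x \<star> u \<in> B" "y \<in> span M"
  shows "y \<star> u \<in> B"
  using assms(3)
  by (induction rule: span_induct_alt)
     (use assms(1,2) in \<open>auto simp: mult_add_left mult_scale_left mult_zero_left' subspace_0
        intro!: subspace_add subspace_scale\<close>)

lemma mult_word_span:
  assumes "x \<in> word_span S i" "y \<in> word_span S j"
  shows "x \<star> y \<in> word_span S (i + j)"
  using assms(1) unfolding word_span_def[of S i]
proof (rule mult_mem_subspace_left[OF subspace_word_span, rotated])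
  fix u assume "u \<in> (\<Union>j\<le>i. words S j)"
  then obtain p where u: "bracketed_word S p u" "p \<le> i" by (auto simp: words_pos)
  show "u \<star> y \<in> word_span S (i + j)"
    using assms(2) unfolding word_span_def[of S j]
  proof (rule mult_mem_subspace_right[OF subspace_word_span, rotated])
    fix v assume "v \<in> (\<Union>i\<le>j. words S i)"
    then obtain q where "bracketed_word S q v" "q \<le> j" by (auto simp: words_pos)
    with u show "u \<star> v \<in> word_span S (i + j)"
      by (intro word_in_word_span[OF bracketed_word.product]) auto
  qed
qed

lemma word_span_all_closed:
  assumes "x \<in> word_span_all S" "y \<in> word_span_all S"
  shows "x \<star> y \<in> word_span_all S"
  using assms mult_word_span unfolding word_span_all_def by blast

lemma subspace_word_span_all: "subspace (word_span_all S)"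
  unfolding subspace_def
proof (intro conjI ballI allI)
  show "0 \<in> word_span_all S"
    using subspace_0[OF subspace_word_span] by (auto simp: word_span_all_def)
next
  fix x y assume "x \<in> word_span_all S" "y \<in> word_span_all S"
  then obtain i j where "x \<in> word_span S i" "y \<in> word_span S j" by (auto simp: word_span_all_def)
  then have "x \<in> word_span S (max i j)" "y \<in> word_span S (max i j)"
    using word_span_mono by (meson max.cobounded1 max.cobounded2 subsetD)+
  then show "x + y \<in> word_span_all S"
    unfolding word_span_all_def using subspace_add[OF subspace_word_span] by blast
next
  fix c x assume "x \<in> word_span_all S"
  then show "c \<cdot> x \<in> word_span_all S"
    unfolding word_span_all_def using subspace_scale[OF subspace_word_span] by blast
qed

text \<open>The union of the filtration is itself a subalgebra that contains the letters.\<close>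

lemma generatingI:
  assumes "\<And>B. subspace B \<Longrightarrow> (\<And>x y. x \<in> B \<Longrightarrow> y \<in> B \<Longrightarrow> x \<star> y \<in> B) \<Longrightarrow> S \<subseteq> B \<Longrightarrow> B = UNIV"
  shows "generating S"
  unfolding generating_def
proof (rule assms[OF subspace_word_span_all word_span_all_closed])
  show "S \<subseteq> word_span_all S"
    unfolding word_span_all_def using letter_in_word_span[of _ S 1] by auto
qed

lemma set_length_gt:
  assumes "generating S" "word_span S k \<noteq> UNIV" "word_span S m = UNIV"
  shows "k < set_length S"
proof (rule ccontr)
  have "word_span S (set_length S) = word_span_all S"
    unfolding set_length_def by (rule LeastI[of _ m]) (use assms in \<open>simp add: generating_def\<close>)
  then have "word_span S (set_length S) = UNIV" using assms(1) by (simp add: generating_def)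
  moreover assume "\<not> k < set_length S"
  ultimately have "word_span S k = UNIV" using word_span_mono[of "set_length S" k S] by auto
  with assms(2) show False by simp
qed

lemma bracketed_word_span_cong:
  assumes "span S \<subseteq> span S'"
  shows "bracketed_word S k x \<Longrightarrow> x \<in> span {y. bracketed_word S' k y}"
proof (induction rule: bracketed_word.induct)
  case (letter x)
  have "span S' \<subseteq> span {y. bracketed_word S' 1 y}"
    by (intro span_mono) (auto intro: bracketed_word.letter[unfolded One_nat_def])
  then show ?case using letter assms span_base[of x S] by blast
next
  case (product p x q y)
  show ?case
  proof (rule mult_mem_subspace_left[OF subspace_span _ product.IH(1)])
    fix u assume u: "u \<in> {y. bracketed_word S' p y}"
    show "u \<star> y \<in> span {y. bracketed_word S' (p + q) y}"
      by (rule mult_mem_subspace_right[OF subspace_span _ product.IH(2)])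
         (use u in \<open>auto intro!: span_base bracketed_word.product\<close>)
  qed
qed

text \<open>Words are multilinear in their letters. This allows one to pass to a basis of the span of the
  letters.\<close>

lemma word_span_cong:
  assumes "span S = span S'"
  shows "word_span S k = word_span S' k"
proof -
  have "word_span M k \<subseteq> word_span Y k" if "span M = span Y" for M Y
  proof (rule word_span_leI[OF subspace_word_span])
    fix j x assume "bracketed_word M j x" "j \<le> k"
    then have "x \<in> span {y. bracketed_word Y j y}" using bracketed_word_span_cong that by blast
    also have "\<dots> \<subseteq> word_span Y k"
      by (intro span_minimal subspace_word_span) (auto intro: word_in_word_span \<open>j \<le> k\<close>)
    finally show "x \<in> word_span Y k" .
  qed
  then show ?thesis using assms by blast
qed

end

section \<open>Growth of the filtration in symmetric composition algebras\<close>

locale nonunital_symmetric_composition =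
  symmetric_composition scale mult n + nonunital_algebra scale mult
  for scale :: "'a::field \<Rightarrow> 'v::ab_group_add \<Rightarrow> 'v" (infixr \<open>\<cdot>\<close> 75)
    and mult :: "'v \<Rightarrow> 'v \<Rightarrow> 'v" (infixl \<open>\<star>\<close> 70) and n
begin

lemma word_length_ge_two:
  assumes "bracketed_word S p u" "2 \<le> p"
  obtains p1 u1 p2 u2 where "p = p1 + p2" "0 < p1" "0 < p2" "u = u1 \<star> u2"
    "bracketed_word S p1 u1" "bracketed_word S p2 u2"
  using assms(1)
proof (cases rule: bracketed_word.cases)
  case letter
  then show ?thesis using assms(2) by simp
next
  case (product m x k y)
  then show ?thesis using bracketed_word_pos[of S m x] bracketed_word_pos[of S k y] that by blast
qed

text \<open>Modulo shorter words, \<open>(u\<^sub>1 \<star> u\<^sub>2) \<star> v\<close> equals \<open>- ((v \<star> u\<^sub>2) \<star> u\<^sub>1)\<close>, and symmetrically on the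
  other side. If the factor that is taken apart is the shorter one, its part \<open>u\<^sub>1\<close> becomes a factor
  of the new product. So the shorter factor shrinks until it is a letter.\<close>

lemma product_reduction:
  assumes "subspace B" "word_span S (p + q - 1) \<subseteq> B"
    and "\<And>s w. s \<in> S \<Longrightarrow> w \<in> word_span S (p + q - 1) \<Longrightarrow> s \<star> w \<in> B \<and> w \<star> s \<in> B"
    and "bracketed_word S p u" "bracketed_word S q v"
  shows "u \<star> v \<in> B"
  using assms
proof (induction "min p q" arbitrary: p q u v rule: less_induct)
  case less
  note B = less.prems(1-3) and u = less.prems(4) and v = less.prems(5)
  note sub = subspace_diff[OF B(1)] subspace_scale[OF B(1)]
  have pos: "0 < p" "0 < q" using bracketed_word_pos u v by auto
  consider "p = 1" | "q = 1" | "2 \<le> p" "p \<le> q" | "2 \<le> q" "q < p" using pos by linarith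
  then show ?case
  proof cases
    case 1
    with u have "u \<in> S" by (auto intro: bracketed_word_one)
    then show ?thesis using B(3) v pos 1 word_in_word_span[OF v, of "p + q - 1"] by auto
  next
    case 2
    with v have "v \<in> S" by (auto intro: bracketed_word_one)
    then show ?thesis using B(3) u pos 2 word_in_word_span[OF u, of "p + q - 1"] by auto
  next
    case 3
    obtain p1 u1 p2 u2 where w: "p = p1 + p2" "0 < p1" "0 < p2" "u = u1 \<star> u2"
      "bracketed_word S p1 u1" "bracketed_word S p2 u2"
      using word_length_ge_two[OF u 3(1)] .
    have "(v \<star> u2) \<star> u1 \<in> B"
    proof (rule less.hyps)
      show "bracketed_word S (q + p2) (v \<star> u2)" using v w by (intro bracketed_word.product)
      have e: "q + p2 + p1 - 1 = p + q - 1" using w by simp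
      show "word_span S (q + p2 + p1 - 1) \<subseteq> B" using B(2) e by simp
      show "\<And>s x. s \<in> S \<Longrightarrow> x \<in> word_span S (q + p2 + p1 - 1) \<Longrightarrow> s \<star> x \<in> B \<and> x \<star> s \<in> B"
        using B(3) e by simp
    qed (use w B 3 in auto)
    moreover have "u2 \<in> B" using B(2) word_in_word_span[OF w(6), of "p + q - 1"] w pos by auto
    ultimately show ?thesis unfolding w(4) swap_left[of u1 u2 v] by (intro sub)
  next
    case 4
    obtain q1 v1 q2 v2 where w: "q = q1 + q2" "0 < q1" "0 < q2" "v = v1 \<star> v2"
      "bracketed_word S q1 v1" "bracketed_word S q2 v2"
      using word_length_ge_two[OF v 4(1)] .
    have "v2 \<star> (v1 \<star> u) \<in> B"
    proof (rule less.hyps)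
      show "bracketed_word S (q1 + p) (v1 \<star> u)" using u w by (intro bracketed_word.product)
      have e: "q2 + (q1 + p) - 1 = p + q - 1" using w by simp
      show "word_span S (q2 + (q1 + p) - 1) \<subseteq> B" using B(2) e by simp
      show "\<And>s x. s \<in> S \<Longrightarrow> x \<in> word_span S (q2 + (q1 + p) - 1) \<Longrightarrow> s \<star> x \<in> B \<and> x \<star> s \<in> B"
        using B(3) e by simp
    qed (use w B 4 in auto)
    moreover have "v1 \<in> B" using B(2) word_in_word_span[OF w(5), of "p + q - 1"] w pos by auto
    ultimately show ?thesis unfolding w(4) swap_right[of u v1 v2] by (intro sub)
  qed
qed

lemma word_span_Suc_leI:
  assumes "1 \<le> k" "subspace B" "word_span S k \<subseteq> B"
    and "\<And>s w. s \<in> S \<Longrightarrow> w \<in> word_span S k \<Longrightarrow> s \<star> w \<in> B \<and> w \<star> s \<in> B"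
  shows "word_span S (Suc k) \<subseteq> B"
proof (rule word_span_leI[OF assms(2)])
  fix j x assume x: "bracketed_word S j x" "j \<le> Suc k"
  show "x \<in> B"
  proof (cases "j \<le> k")
    case True
    then show ?thesis using x word_in_word_span assms(3) by blast
  next
    case False
    then have j: "j = Suc k" using x by simp
    then have "2 \<le> j" using assms(1) by simp
    from word_length_ge_two[OF x(1) this] obtain p u q v where
      w: "j = p + q" "x = u \<star> v" "bracketed_word S p u" "bracketed_word S q v" by metis
    have "p + q - 1 = k" using w j by simp
    then show ?thesis unfolding w(2)
      using product_reduction[OF assms(2) _ _ w(3,4)] assms(3,4) by simp
  qed
qed

text \<open>For nonassociative words one repetition in the filtration does not in general make it
  stationary. Here it does, because only products with a letter have to be considered.\<close>

lemma word_span_stable: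
  assumes "1 \<le> k" "word_span S (Suc k) \<subseteq> word_span S k"
  shows "word_span S m \<subseteq> word_span S k"
proof (induction m)
  case 0
  show ?case by (rule word_span_mono) simp
next
  case (Suc m)
  show ?case
  proof (cases "m < k")
    case True
    then show ?thesis by (intro word_span_mono) simp
  next
    case False
    show ?thesis
    proof (rule word_span_Suc_leI[OF _ subspace_word_span Suc.IH])
      show "1 \<le> m" using False assms(1) by simp
      fix s w assume "s \<in> S" "w \<in> word_span S m"
      then have "s \<in> word_span S 1" "w \<in> word_span S k"
        using Suc.IH by (auto intro: letter_in_word_span)
      then show "s \<star> w \<in> word_span S k \<and> w \<star> s \<in> word_span S k"
        using mult_word_span[of s S 1 w k] mult_word_span[of w S k s 1] assms(2) by auto
    qed
  qed
qed

text \<open>If one further vector \<open>p\<close> spans the step from length \<open>k\<close> to length \<open>k + 1\<close>, the next step is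
  controlled by the products of \<open>p\<close> with letters.\<close>

lemma one_step_stable:
  assumes "1 \<le> k" "word_span S (Suc k) \<subseteq> span (insert p (word_span S k))"
    and "\<And>s. s \<in> S \<Longrightarrow> s \<star> p \<in> word_span S (Suc k) \<and> p \<star> s \<in> word_span S (Suc k)"
  shows "word_span S (Suc (Suc k)) \<subseteq> word_span S (Suc k)"
proof (rule word_span_Suc_leI[OF _ subspace_word_span order.refl])
  show "1 \<le> Suc k" by simp
  fix s w assume s: "s \<in> S" and w: "w \<in> word_span S (Suc k)"
  have s1: "s \<in> word_span S 1" using s by (simp add: letter_in_word_span)
  have "w \<in> span (insert p (word_span S k))" using w assms(2) by blast
  then obtain c where c: "w - c \<cdot> p \<in> word_span S k"
    unfolding span_breakdown_eq by (metis span_eq_iff subspace_word_span)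
  define l where "l = w - c \<cdot> p"
  have w': "w = l + c \<cdot> p" by (simp add: l_def)
  have "s \<star> l \<in> word_span S (Suc k)" "l \<star> s \<in> word_span S (Suc k)"
    using c mult_word_span[OF s1, of l k] mult_word_span[OF _ s1, of l k] by (simp_all add: l_def)
  then show "s \<star> w \<in> word_span S (Suc k) \<and> w \<star> s \<in> word_span S (Suc k)"
    using assms(3)[OF s] unfolding w' mult_linear
    by (intro conjI subspace_add[OF subspace_word_span] subspace_scale[OF subspace_word_span]) auto
qed

lemma Suc_numerals: "Suc 1 = 2" "Suc 2 = 3" "Suc 3 = 4" "Suc 4 = 5" by simp_all

lemma letters_product: "s \<in> S \<Longrightarrow> t \<in> S \<Longrightarrow> s \<star> t \<in> word_span S 2"
  using mult_word_span[of s S 1 t 1, unfolded one_add_one] letter_in_word_span[of _ S 1] by blast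

lemma letter_times:
  assumes "s \<in> S" "w \<in> word_span S k"
  shows "s \<star> w \<in> word_span S (Suc k)" "w \<star> s \<in> word_span S (Suc k)"
  using mult_word_span[of s S 1 w k] mult_word_span[of w S k s 1] letter_in_word_span[of s S 1] assms
  by simp_all

lemma product_of_two_in_word_span: "s \<in> S \<Longrightarrow> t \<in> S \<Longrightarrow> 2 \<le> k \<Longrightarrow> s \<star> t \<in> word_span S k"
  using letters_product word_span_mono[of 2 k S] by blast

lemma word_span_linear:
  "x \<in> word_span S k \<Longrightarrow> y \<in> word_span S k \<Longrightarrow> x - y \<in> word_span S k"
  "x \<in> word_span S k \<Longrightarrow> y \<in> word_span S k \<Longrightarrow> x + y \<in> word_span S k"
  "x \<in> word_span S k \<Longrightarrow> c \<cdot> x \<in> word_span S k"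
  by (intro subspace_diff subspace_add subspace_scale subspace_word_span; assumption)+

lemma in_span_insertE:
  assumes "x \<in> span (insert p (word_span S k))"
  obtains c l where "x = l + c \<cdot> p" "l \<in> word_span S k"
proof -
  obtain c where "x - c \<cdot> p \<in> word_span S k"
    using assms unfolding span_breakdown_eq by (metis span_eq_iff subspace_word_span)
  then show ?thesis using that[of "x - c \<cdot> p" c] by simp
qed

text \<open>Let \<open>p = x \<star> y\<close> span the new words of length two. Swapping turns \<open>p \<star> z\<close> into
  \<open>- ((z \<star> y) \<star> x)\<close>, and \<open>z \<star> y\<close> is a multiple of \<open>p\<close> up to a combination of letters, while
  \<open>p \<star> x = n x \<cdot> y\<close> is short. The other side is symmetric, with \<open>y \<star> p = n y \<cdot> x\<close>.\<close>

lemma length_three_stable: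
  assumes step: "\<And>p. p \<in> word_span S 2 \<Longrightarrow> p \<notin> word_span S 1 \<Longrightarrow>
    word_span S 2 \<subseteq> span (insert p (word_span S 1))"
  shows "word_span S 3 \<subseteq> word_span S 2"
proof (cases "word_span S 2 \<subseteq> word_span S 1")
  case True
  then have "word_span S (Suc 1) \<subseteq> word_span S 1" by (simp only: Suc_numerals)
  then have "word_span S 3 \<subseteq> word_span S 1" by (rule word_span_stable[rotated]) simp_all
  then show ?thesis using word_span_mono[of 1 2 S] by auto
next
  case False
  have "\<exists>x\<in>S. \<exists>y\<in>S. x \<star> y \<notin> word_span S 1"
  proof (rule ccontr)
    assume *: "\<not> ?thesis"
    have "word_span S (Suc 1) \<subseteq> word_span S 1"
    proof (rule word_span_Suc_leI[OF _ subspace_word_span])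
      fix s w assume s: "s \<in> S" and "w \<in> word_span S 1"
      then have w: "w \<in> span S" by (metis word_span_one)
      show "s \<star> w \<in> word_span S 1 \<and> w \<star> s \<in> word_span S 1"
        using s * by (intro conjI mult_mem_subspace_right[OF subspace_word_span _ w]
            mult_mem_subspace_left[OF subspace_word_span _ w]) auto
    qed simp_all
    then show False using False by (simp only: Suc_numerals)
  qed
  then obtain x y where xy: "x \<in> S" "y \<in> S" "x \<star> y \<notin> word_span S 1" by blast
  define p where "p = x \<star> y"
  have L2: "word_span S 2 \<subseteq> span (insert p (word_span S 1))"
    by (rule step) (use xy letters_product in \<open>auto simp: p_def\<close>)
  have letter: "s \<in> S \<Longrightarrow> s \<in> word_span S 2" for s by (rule letter_in_word_span) auto
  have "word_span S (Suc (Suc 1)) \<subseteq> word_span S (Suc 1)"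
  proof (rule one_step_stable)
    show "word_span S (Suc 1) \<subseteq> span (insert p (word_span S 1))" using L2 by (simp only: Suc_numerals)
    fix z assume z: "z \<in> S"
    obtain c l where zy: "z \<star> y = l + c \<cdot> p" "l \<in> word_span S 1"
      using in_span_insertE[OF subsetD[OF L2 letters_product[OF z xy(2)]]] .
    obtain d m where xz: "x \<star> z = m + d \<cdot> p" "m \<in> word_span S 1"
      using in_span_insertE[OF subsetD[OF L2 letters_product[OF xy(1) z]]] .
    have px: "p \<star> x = n x \<cdot> y" "y \<star> p = n y \<cdot> x" by (simp_all add: p_def comp_left comp_right)
    then have "(z \<star> y) \<star> x = l \<star> x + c \<cdot> n x \<cdot> y" "y \<star> (x \<star> z) = y \<star> m + d \<cdot> n y \<cdot> x"
      by (simp_all only: zy xz mult_linear px)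
    then have "(z \<star> y) \<star> x \<in> word_span S 2" "y \<star> (x \<star> z) \<in> word_span S 2"
      using letter_times(2)[OF xy(1) zy(2)] letter_times(1)[OF xy(2) xz(2)] xy letter
      unfolding Suc_numerals by (simp_all add: word_span_linear del: scale_scale)
    then have "p \<star> z \<in> word_span S 2" "z \<star> p \<in> word_span S 2"
      using xy letter unfolding p_def swap_left[of x y z] swap_right[of z x y]
      by (simp_all add: word_span_linear)
    then show "z \<star> p \<in> word_span S (Suc 1) \<and> p \<star> z \<in> word_span S (Suc 1)"
      by (simp only: Suc_numerals)
  qed simp
  then show ?thesis by (simp only: Suc_numerals)
qed

lemma word_span_two: "word_span S 2 = span (S \<union> {s \<star> t | s t. s \<in> S \<and> t \<in> S})"
  (is "_ = span ?W")
proof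
  have "word_span S (Suc 1) \<subseteq> span ?W"
  proof (rule word_span_Suc_leI[OF _ subspace_span])
    show "word_span S 1 \<subseteq> span ?W" unfolding word_span_one by (rule span_mono) auto
    fix s w assume s: "s \<in> S" and "w \<in> word_span S 1"
    then have w: "w \<in> span S" by (metis word_span_one)
    show "s \<star> w \<in> span ?W \<and> w \<star> s \<in> span ?W"
      using s by (intro conjI mult_mem_subspace_right[OF subspace_span _ w]
            mult_mem_subspace_left[OF subspace_span _ w]) (auto intro!: span_base)
  qed simp
  then show "word_span S 2 \<subseteq> span ?W" by (simp only: Suc_numerals)
  show "span ?W \<subseteq> word_span S 2"
    by (intro span_minimal subspace_word_span) (auto intro: letters_product letter_in_word_span)
qed

lemma word_span_three_leI:
  assumes "subspace B" "word_span S 2 \<subseteq> B"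
    and "\<And>x y z. x \<in> S \<Longrightarrow> y \<in> S \<Longrightarrow> z \<in> S \<Longrightarrow> (x \<star> y) \<star> z \<in> B \<and> x \<star> (y \<star> z) \<in> B"
  shows "word_span S 3 \<subseteq> B"
proof -
  have "word_span S (Suc 2) \<subseteq> B"
  proof (rule word_span_Suc_leI[OF _ assms(1,2)])
    fix s w assume s: "s \<in> S" and "w \<in> word_span S 2"
    then have w: "w \<in> span (S \<union> {s \<star> t | s t. s \<in> S \<and> t \<in> S})" by (metis word_span_two)
    show "s \<star> w \<in> B \<and> w \<star> s \<in> B"
      using s assms(2,3) letters_product
      by (intro conjI mult_mem_subspace_right[OF assms(1) _ w]
            mult_mem_subspace_left[OF assms(1) _ w]) blast+
  qed simp
  then show ?thesis by (simp only: Suc_numerals)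
qed

lemma word_span_three: "word_span S 3 = span (word_span S 2 \<union>
    {(x \<star> y) \<star> z | x y z. x \<in> S \<and> y \<in> S \<and> z \<in> S} \<union> {x \<star> (y \<star> z) | x y z. x \<in> S \<and> y \<in> S \<and> z \<in> S})"
  (is "_ = span ?W")
proof
  show "word_span S 3 \<subseteq> span ?W"
  proof (rule word_span_three_leI)
    fix x y z assume "x \<in> S" "y \<in> S" "z \<in> S"
    then have "(x \<star> y) \<star> z \<in> ?W" "x \<star> (y \<star> z) \<in> ?W" by blast+
    then show "(x \<star> y) \<star> z \<in> span ?W \<and> x \<star> (y \<star> z) \<in> span ?W" by (simp only: span_base)
  next
    show "subspace (span ?W)" by simp
    show "word_span S 2 \<subseteq> span ?W" by (rule order_trans[OF _ span_superset]) (simp add: Un_assoc)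
  qed
  have "(x \<star> y) \<star> z \<in> word_span S 3 \<and> x \<star> (y \<star> z) \<in> word_span S 3"
    if "x \<in> S" "y \<in> S" "z \<in> S" for x y z
    using letter_times[OF that(3) letters_product[OF that(1,2)]]
      letter_times[OF that(1) letters_product[OF that(2,3)]] by (simp only: Suc_numerals)
  moreover have "word_span S 2 \<subseteq> word_span S 3" by (rule word_span_mono) simp
  ultimately show "span ?W \<subseteq> word_span S 3"
    by (intro span_minimal subspace_word_span) blast
qed

text \<open>The new words of length three are spanned by one word \<open>p\<close>, say \<open>p = (x \<star> y) \<star> z\<close>. Swapping
  turns \<open>w \<star> p\<close> into \<open>- (z \<star> ((x \<star> y) \<star> w))\<close>, which is a multiple of \<open>z \<star> p = n z \<cdot> (x \<star> y)\<close> up to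
  words of length three. Swapping twice turns \<open>p \<star> w\<close> into \<open>y \<star> (x \<star> (w \<star> z))\<close>, which is a
  multiple of \<open>y \<star> p\<close> and so reduces to the first case. If \<open>p = x \<star> (y \<star> z)\<close>, the two sides
  change roles.\<close>

lemma length_four_stable:
  assumes step: "\<And>p. p \<in> word_span S 3 \<Longrightarrow> p \<notin> word_span S 2 \<Longrightarrow>
    word_span S 3 \<subseteq> span (insert p (word_span S 2))"
  shows "word_span S 4 \<subseteq> word_span S 3"
proof (cases "word_span S 3 \<subseteq> word_span S 2")
  case True
  then have "word_span S (Suc 2) \<subseteq> word_span S 2" by (simp only: Suc_numerals)
  then have "word_span S 4 \<subseteq> word_span S 2" by (rule word_span_stable[rotated]) simp_all
  then show ?thesis using word_span_mono[of 2 3 S] by auto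
next
  case False
  have two: "s \<in> S \<Longrightarrow> t \<in> S \<Longrightarrow> s \<star> t \<in> word_span S 3" for s t
    by (rule product_of_two_in_word_span) auto
  have letter: "s \<in> S \<Longrightarrow> s \<in> word_span S 3" for s by (rule letter_in_word_span) auto
  have times: "s \<in> S \<Longrightarrow> l \<in> word_span S 2 \<Longrightarrow> s \<star> l \<in> word_span S 3"
    "s \<in> S \<Longrightarrow> l \<in> word_span S 2 \<Longrightarrow> l \<star> s \<in> word_span S 3" for s l
    using letter_times[of s S l 2] by (simp_all only: Suc_numerals)
  have in3: "(x \<star> y) \<star> z \<in> word_span S 3" "x \<star> (y \<star> z) \<in> word_span S 3"
    if "x \<in> S" "y \<in> S" "z \<in> S" for x y z
    using that by (simp_all only: times letters_product)
  obtain x y z where xyz: "x \<in> S" "y \<in> S" "z \<in> S"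
    and *: "(x \<star> y) \<star> z \<notin> word_span S 2 \<or> x \<star> (y \<star> z) \<notin> word_span S 2"
    using False word_span_three_leI[OF subspace_word_span order.refl, of S] by blast
  have "word_span S (Suc (Suc 2)) \<subseteq> word_span S (Suc 2)"
    using *
  proof
    assume *: "(x \<star> y) \<star> z \<notin> word_span S 2"
    define p where "p = (x \<star> y) \<star> z"
    have L3: "word_span S 3 \<subseteq> span (insert p (word_span S 2))"
      by (rule step) (use xyz in3 * in \<open>auto simp: p_def\<close>)
    have zp: "z \<star> p = n z \<cdot> (x \<star> y)" by (simp add: p_def comp_right)
    have left: "w \<star> p \<in> word_span S 3" if w: "w \<in> S" for w
    proof -
      obtain c l where xyw: "(x \<star> y) \<star> w = l + c \<cdot> p" "l \<in> word_span S 2"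
        using in_span_insertE[OF subsetD[OF L3 in3(1)[OF xyz(1,2) w]]] .
      have "w \<star> p = polar w z \<cdot> (x \<star> y) - (z \<star> l + c \<cdot> n z \<cdot> (x \<star> y))"
        unfolding p_def swap_right[of w "x \<star> y" z] unfolding xyw by (simp only: mult_linear zp)
      then show ?thesis
        using times(1)[OF xyz(3) xyw(2)] two[OF xyz(1,2)]
        by (simp add: word_span_linear del: scale_scale)
    qed
    have right: "p \<star> w \<in> word_span S 3" if w: "w \<in> S" for w
    proof -
      obtain c l where xwz: "x \<star> (w \<star> z) = l + c \<cdot> p" "l \<in> word_span S 2"
        using in_span_insertE[OF subsetD[OF L3 in3(2)[OF xyz(1) w xyz(3)]]] .
      have "p \<star> w = polar (x \<star> y) w \<cdot> z - (polar (w \<star> z) y \<cdot> x - (y \<star> l + c \<cdot> (y \<star> p)))"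
        unfolding p_def swap_left[of "x \<star> y" z w] swap_right[of "w \<star> z" x y] unfolding xwz
        by (simp only: mult_linear p_def)
      then show ?thesis
        using times(1)[OF xyz(2) xwz(2)] left[OF xyz(2)] letter[OF xyz(1)] letter[OF xyz(3)]
        by (simp add: word_span_linear del: scale_scale)
    qed
    show ?thesis
      unfolding Suc_numerals
      using one_step_stable[of 2 _ p, unfolded Suc_numerals, OF _ L3] left right by simp
  next
    assume *: "x \<star> (y \<star> z) \<notin> word_span S 2"
    define p where "p = x \<star> (y \<star> z)"
    have L3: "word_span S 3 \<subseteq> span (insert p (word_span S 2))"
      by (rule step) (use xyz in3 * in \<open>auto simp: p_def\<close>)
    have px: "p \<star> x = n x \<cdot> (y \<star> z)" by (simp add: p_def comp_left)
    have right: "p \<star> w \<in> word_span S 3" if w: "w \<in> S" for w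
    proof -
      obtain c l where wyz: "w \<star> (y \<star> z) = l + c \<cdot> p" "l \<in> word_span S 2"
        using in_span_insertE[OF subsetD[OF L3 in3(2)[OF w xyz(2,3)]]] .
      have "p \<star> w = polar x w \<cdot> (y \<star> z) - (l \<star> x + c \<cdot> n x \<cdot> (y \<star> z))"
        unfolding p_def swap_left[of x "y \<star> z" w] unfolding wyz by (simp only: mult_linear px)
      then show ?thesis
        using times(2)[OF xyz(1) wyz(2)] two[OF xyz(2,3)]
        by (simp add: word_span_linear del: scale_scale)
    qed
    have left: "w \<star> p \<in> word_span S 3" if w: "w \<in> S" for w
    proof -
      obtain c l where xwz: "(x \<star> w) \<star> z = l + c \<cdot> p" "l \<in> word_span S 2"
        using in_span_insertE[OF subsetD[OF L3 in3(1)[OF xyz(1) w xyz(3)]]] .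
      have "w \<star> p = polar w (y \<star> z) \<cdot> x - (polar y (x \<star> w) \<cdot> z - (l \<star> y + c \<cdot> (p \<star> y)))"
        unfolding p_def swap_right[of w x "y \<star> z"] swap_left[of y z "x \<star> w"] unfolding xwz
        by (simp only: mult_linear p_def)
      then show ?thesis
        using times(2)[OF xyz(2) xwz(2)] right[OF xyz(2)] letter[OF xyz(1)] letter[OF xyz(3)]
        by (simp add: word_span_linear del: scale_scale)
    qed
    show ?thesis
      unfolding Suc_numerals
      using one_step_stable[of 2 _ p, unfolded Suc_numerals, OF _ L3] left right by simp
  qed
  then show ?thesis by (simp only: Suc_numerals)
qed

text \<open>Words of length four of the form \<open>w \<star> ((x \<star> y) \<star> z)\<close> change sign under transpositions of
  \<open>w\<close>, \<open>x\<close>, \<open>z\<close> and vanish when two of these agree, modulo shorter words; so with two letters they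
  reduce. Their mirror images do so as well, and the other words reduce to the form \<open>(x \<star> y) \<star> (z \<star> w)\<close>. If one
  such \<open>p\<close> spans the new words, then \<open>u \<star> p\<close> becomes a multiple of \<open>x \<star> p\<close> by three swaps, and
  \<open>x \<star> p\<close> is short because \<open>(x \<star> y) \<star> x = n x \<cdot> y\<close>.\<close>

lemma length_five_stable_two_letters:
  assumes step: "\<And>p. p \<in> word_span {a, b} 4 \<Longrightarrow> p \<notin> word_span {a, b} 3 \<Longrightarrow>
    word_span {a, b} 4 \<subseteq> span (insert p (word_span {a, b} 3))"
  shows "word_span {a, b} 5 \<subseteq> word_span {a, b} 4"
proof (cases "\<exists>x\<in>{a, b}. \<exists>y\<in>{a, b}. \<exists>z\<in>{a, b}. \<exists>w\<in>{a, b}. (x \<star> y) \<star> (z \<star> w) \<notin> word_span {a, b} 3")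
  case False
  let ?S = "{a, b}"
  have two: "s \<in> ?S \<Longrightarrow> t \<in> ?S \<Longrightarrow> s \<star> t \<in> word_span ?S 3" for s t
    by (rule product_of_two_in_word_span) auto
  have letter: "s \<in> ?S \<Longrightarrow> s \<in> word_span ?S 3" for s by (rule letter_in_word_span) auto
  have times: "s \<in> ?S \<Longrightarrow> l \<in> word_span ?S 2 \<Longrightarrow> s \<star> l \<in> word_span ?S 3"
    "s \<in> ?S \<Longrightarrow> l \<in> word_span ?S 2 \<Longrightarrow> l \<star> s \<in> word_span ?S 3" for s l
    using letter_times[of s ?S l 2] by (simp_all only: Suc_numerals)
  have in3: "(x \<star> y) \<star> z \<in> word_span ?S 3" "x \<star> (y \<star> z) \<in> word_span ?S 3"
    if "x \<in> ?S" "y \<in> ?S" "z \<in> ?S" for x y z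
    using that by (simp_all only: times letters_product)
  have balanced: "(x \<star> y) \<star> (z \<star> w) \<in> word_span ?S 3"
    if "x \<in> ?S" "y \<in> ?S" "z \<in> ?S" "w \<in> ?S" for x y z w using False that by blast
  have alternating_left: "w \<star> ((x \<star> y) \<star> z) \<in> word_span ?S 3"
    if mem: "x \<in> ?S" "y \<in> ?S" "z \<in> ?S" "w \<in> ?S" for x y z w
  proof -
    consider "w = z" | "x = z" | "w = x" using mem by auto
    then show ?thesis
    proof cases
      case 1
      then show ?thesis using two mem by (simp only: comp_right word_span_linear)
    next
      case 2
      then show ?thesis using two mem by (simp only: comp_left mult_linear word_span_linear)
    next
      case 3
      then show ?thesis using two mem unfolding swap_right[of w "x \<star> y" z]
        by (simp only: comp_left mult_linear word_span_linear)
    qed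
  qed
  have alternating_right: "(z \<star> (y \<star> x)) \<star> w \<in> word_span ?S 3"
    if mem: "x \<in> ?S" "y \<in> ?S" "z \<in> ?S" "w \<in> ?S" for x y z w
  proof -
    consider "w = z" | "x = z" | "w = x" using mem by auto
    then show ?thesis
    proof cases
      case 1
      then show ?thesis using two mem by (simp only: comp_left word_span_linear)
    next
      case 2
      then show ?thesis using two mem by (simp only: comp_right mult_linear word_span_linear)
    next
      case 3
      then show ?thesis using two mem unfolding swap_left[of z "y \<star> x" w]
        by (simp only: comp_right mult_linear word_span_linear)
    qed
  qed
  have mixed_left: "w \<star> (x \<star> (y \<star> z)) \<in> word_span ?S 3"
    if "x \<in> ?S" "y \<in> ?S" "z \<in> ?S" "w \<in> ?S" for x y z w
    unfolding swap_right[of w x "y \<star> z"]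
    using that letter balanced by (intro word_span_linear) auto
  have mixed_right: "((x \<star> y) \<star> z) \<star> w \<in> word_span ?S 3"
    if "x \<in> ?S" "y \<in> ?S" "z \<in> ?S" "w \<in> ?S" for x y z w
    unfolding swap_left[of "x \<star> y" z w]
    using that letter balanced by (intro word_span_linear) auto
  have "word_span ?S (Suc 3) \<subseteq> word_span ?S 3"
  proof (rule word_span_Suc_leI[OF _ subspace_word_span order.refl])
    fix s w assume s: "s \<in> ?S" and w: "w \<in> word_span ?S 3"
    note w' = w[unfolded word_span_three]
    have gen: "s \<star> t \<in> word_span ?S 3 \<and> t \<star> s \<in> word_span ?S 3"
      if "t \<in> word_span ?S 2 \<union> {(x \<star> y) \<star> z | x y z. x \<in> ?S \<and> y \<in> ?S \<and> z \<in> ?S} \<union>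
        {x \<star> (y \<star> z) | x y z. x \<in> ?S \<and> y \<in> ?S \<and> z \<in> ?S}" for t
      using that
    proof (elim UnE)
      assume "t \<in> word_span ?S 2"
      then show ?thesis using times s by blast
    next
      assume "t \<in> {(x \<star> y) \<star> z | x y z. x \<in> ?S \<and> y \<in> ?S \<and> z \<in> ?S}"
      then obtain x y z where t: "t = (x \<star> y) \<star> z" "x \<in> ?S" "y \<in> ?S" "z \<in> ?S" by blast
      show ?thesis unfolding t(1)
        using alternating_left[OF t(2-4) s] mixed_right[OF t(2-4) s] by (rule conjI)
    next
      assume "t \<in> {x \<star> (y \<star> z) | x y z. x \<in> ?S \<and> y \<in> ?S \<and> z \<in> ?S}"
      then obtain x y z where t: "t = x \<star> (y \<star> z)" "x \<in> ?S" "y \<in> ?S" "z \<in> ?S" by blast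
      show ?thesis unfolding t(1)
        using mixed_left[OF t(2-4) s] alternating_right[OF t(4,3,2) s] by (rule conjI)
    qed
    show "s \<star> w \<in> word_span ?S 3 \<and> w \<star> s \<in> word_span ?S 3"
      by (rule conjI;
          (rule mult_mem_subspace_right[OF subspace_word_span _ w'] conjunct1[OF gen]
            mult_mem_subspace_left[OF subspace_word_span _ w'] conjunct2[OF gen] | assumption)+)
  qed simp
  then have "word_span ?S 5 \<subseteq> word_span ?S 3" by (rule word_span_stable[rotated]) simp_all
  then show ?thesis using word_span_mono[of 3 4 ?S] by auto
next
  case True
  let ?S = "{a, b}"
  obtain x y z w where xyzw: "x \<in> ?S" "y \<in> ?S" "z \<in> ?S" "w \<in> ?S"
    and *: "(x \<star> y) \<star> (z \<star> w) \<notin> word_span ?S 3" using True by auto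
  define p where "p = (x \<star> y) \<star> (z \<star> w)"
  have balanced: "(x \<star> y) \<star> (z \<star> w) \<in> word_span ?S 4"
    if "x \<in> ?S" "y \<in> ?S" "z \<in> ?S" "w \<in> ?S" for x y z w
    using mult_word_span[OF letters_product letters_product] that by fastforce
  have L4: "word_span ?S 4 \<subseteq> span (insert p (word_span ?S 3))"
    by (rule step) (use xyzw balanced * in \<open>auto simp: p_def\<close>)
  have two: "s \<in> ?S \<Longrightarrow> t \<in> ?S \<Longrightarrow> s \<star> t \<in> word_span ?S 4" for s t
    by (rule product_of_two_in_word_span) auto
  have times: "s \<in> ?S \<Longrightarrow> l \<in> word_span ?S 3 \<Longrightarrow> s \<star> l \<in> word_span ?S 4"
    "s \<in> ?S \<Longrightarrow> l \<in> word_span ?S 3 \<Longrightarrow> l \<star> s \<in> word_span ?S 4" for s l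
    using letter_times[of s ?S l 3] by (simp_all only: Suc_numerals)
  have three: "(u \<star> v) \<star> t \<in> word_span ?S 4" "u \<star> (v \<star> t) \<in> word_span ?S 4"
    if "u \<in> ?S" "v \<in> ?S" "t \<in> ?S" for u v t
    using that product_of_two_in_word_span[of _ ?S _ 3] by (simp_all only: times)
  have xp: "x \<star> p \<in> word_span ?S 4"
    unfolding p_def swap_right[of x "x \<star> y" "z \<star> w"] comp_left mult_scale_right
    by (simp only: word_span_linear two[OF xyzw(1,2)] three(1)[OF xyzw(3,4,2)])
  have pw: "p \<star> w \<in> word_span ?S 4"
    unfolding p_def swap_left[of "x \<star> y" "z \<star> w" w] comp_right mult_scale_left
    by (simp only: word_span_linear two[OF xyzw(3,4)] three(2)[OF xyzw(3,1,2)])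
  have left: "u \<star> p \<in> word_span ?S 4" if u: "u \<in> ?S" for u
  proof -
    obtain c l where uyzw: "(u \<star> y) \<star> (z \<star> w) = l + c \<cdot> p" "l \<in> word_span ?S 3"
      using in_span_insertE[OF subsetD[OF L4 balanced[OF u xyzw(2-4)]]] .
    have "u \<star> p = polar u (z \<star> w) \<cdot> (x \<star> y) - (polar x u \<cdot> ((z \<star> w) \<star> y)
        - (polar (z \<star> w) x \<cdot> (u \<star> y) - (x \<star> l + c \<cdot> (x \<star> p))))"
      unfolding p_def swap_right[of u "x \<star> y" "z \<star> w"] swap_left[of x y u]
      by (simp only: mult_linear swap_right[of "z \<star> w" "u \<star> y" x] uyzw p_def[symmetric])
    then show ?thesis
      using times(1)[OF xyzw(1) uyzw(2)] xp two[OF xyzw(1,2)] two[OF u xyzw(2)]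
        three(1)[OF xyzw(3,4,2)]
      by (simp add: word_span_linear del: scale_scale)
  qed
  have right: "p \<star> u \<in> word_span ?S 4" if u: "u \<in> ?S" for u
  proof -
    obtain c l where xyzu: "(x \<star> y) \<star> (z \<star> u) = l + c \<cdot> p" "l \<in> word_span ?S 3"
      using in_span_insertE[OF subsetD[OF L4 balanced[OF xyzw(1-3) u]]] .
    have "p \<star> u = polar (x \<star> y) u \<cdot> (z \<star> w) - (polar u w \<cdot> (z \<star> (x \<star> y))
        - (polar w (x \<star> y) \<cdot> (z \<star> u) - (l \<star> w + c \<cdot> (p \<star> w))))"
      unfolding p_def swap_left[of "x \<star> y" "z \<star> w" u] swap_right[of u z w]
      by (simp only: mult_linear swap_left[of w "z \<star> u" "x \<star> y"] xyzu p_def[symmetric])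
    then show ?thesis
      using times(2)[OF xyzw(4) xyzu(2)] pw two[OF xyzw(3,4)] two[OF xyzw(3) u]
        three(2)[OF xyzw(3,1,2)]
      by (simp add: word_span_linear del: scale_scale)
  qed
  have "word_span ?S (Suc (Suc 3)) \<subseteq> word_span ?S (Suc 3)"
    unfolding Suc_numerals
      using one_step_stable[of 3 _ p, unfolded Suc_numerals, OF _ L4] left right by simp
  then show ?thesis by (simp only: Suc_numerals)
qed

end

section \<open>The upper bound in dimension eight\<close>

text \<open>The last condition separates Okubo algebras from para-Hurwitz algebras, in which the para-unit
  commutes with every element.\<close>

locale eight_dim_symmetric_composition =
  symmetric_composition scale mult n + finite_dimensional_vector_space scale Basis
  for scale :: "'a::field \<Rightarrow> 'v::ab_group_add \<Rightarrow> 'v" (infixr \<open>\<cdot>\<close> 75)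
    and mult :: "'v \<Rightarrow> 'v \<Rightarrow> 'v" (infixl \<open>\<star>\<close> 70) and n and Basis +
  assumes card_Basis: "card Basis = 8"
    and polar_nondegenerate: "(\<And>y. polar x y = 0) \<Longrightarrow> x = 0"
    and commuting_eq_zero: "(\<And>y. x \<star> y = y \<star> x) \<Longrightarrow> x = 0"
begin

sublocale nonunital_symmetric_composition scale mult n
proof unfold_locales
  fix e
  show "\<not> (\<forall>x. e \<star> x = x \<and> x \<star> e = x)"
  proof
    assume unit: "\<forall>x. e \<star> x = x \<and> x \<star> e = x"
    then have "e = 0" by (intro commuting_eq_zero) simp
    then show False using unit exists_nonzero by auto
  qed
qed

lemma dim_UNIV: "dim UNIV = 8"
  using dimension_def card_Basis dim_UNIV by simp

text \<open>This turns a bound on dimensions into the hypothesis of the three stability lemmas.\<close>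

lemma subspace_increment:
  assumes "subspace U" "subspace W" "U \<subseteq> W" "dim W \<le> dim U + 1" "p \<in> W" "p \<notin> U"
  shows "W \<subseteq> span (insert p U)"
proof -
  have "span U = U" using assms(1) span_eq_iff by blast
  have "dim (insert p U) = dim U + 1"
    using dim_insert[of p U] assms(6) \<open>span U = U\<close> by simp
  moreover have "insert p U \<subseteq> W" using assms(3,5) by blast
  ultimately show ?thesis using card_ge_dim_independent
    by (metis assms(2,4) dim_eq_span dim_subset le_antisym order_refl span_eq_iff)
qed

lemma step_if_small:
  assumes "i \<le> j" "dim (word_span S j) \<le> dim (word_span S i) + 1"
    "p \<in> word_span S j" "p \<notin> word_span S i"
  shows "word_span S j \<subseteq> span (insert p (word_span S i))"
  by (rule subspace_increment) (use assms subspace_word_span word_span_mono in auto)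

lemma dim_strict:
  assumes "i \<le> j" "\<not> word_span S j \<subseteq> word_span S i"
  shows "dim (word_span S i) < dim (word_span S j)"
proof -
  have "word_span S i \<subset> word_span S j" using assms word_span_mono by blast
  then show ?thesis
    by (intro dim_psubset) (simp add: subspace_word_span span_eq_iff[THEN iffD2])
qed

text \<open>If length four did not suffice, all increments up to length five would be positive. The
  increments to lengths two and three are then at least two, and together with \<open>d\<^sub>1 \<ge> 2\<close> this
  leaves no room except for two letters and an increment of one to length four.\<close>

lemma word_span_four:
  assumes "generating S"
  shows "word_span S 4 = UNIV"
proof (rule ccontr)
  assume proper: "word_span S 4 \<noteq> UNIV"
  have unstable: "\<not> word_span S (Suc k) \<subseteq> word_span S k" if "1 \<le> k" "k \<le> 4" for k
  proof
    assume "word_span S (Suc k) \<subseteq> word_span S k"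
    then have "word_span S m \<subseteq> word_span S k" for m using word_span_stable that by blast
    moreover have "word_span S k \<subseteq> word_span S 4" by (rule word_span_mono) (rule that)
    ultimately have "word_span_all S \<subseteq> word_span S 4" unfolding word_span_all_def by blast
    then show False using assms proper unfolding generating_def by auto
  qed
  have u: "\<not> word_span S 2 \<subseteq> word_span S 1" "\<not> word_span S 3 \<subseteq> word_span S 2"
    "\<not> word_span S 4 \<subseteq> word_span S 3" "\<not> word_span S 5 \<subseteq> word_span S 4"
    using unstable[of 1] unstable[of 2] unstable[of 3] unstable[of 4]
    unfolding Suc_numerals by simp_all
  let ?d = "\<lambda>k. dim (word_span S k)"
  have d2: "?d 1 + 2 \<le> ?d 2"
  proof (rule ccontr)
    assume "\<not> ?thesis"
    then have "?d 2 \<le> ?d 1 + 1" by simp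
    then have "word_span S 3 \<subseteq> word_span S 2"
      by (intro length_three_stable step_if_small) simp_all
    then show False using u by simp
  qed
  have d3: "?d 2 + 2 \<le> ?d 3"
  proof (rule ccontr)
    assume "\<not> ?thesis"
    then have "?d 3 \<le> ?d 2 + 1" by simp
    then have "word_span S 4 \<subseteq> word_span S 3"
      by (intro length_four_stable step_if_small) simp_all
    then show False using u by simp
  qed
  have d4: "?d 3 + 1 \<le> ?d 4" "?d 4 + 1 \<le> ?d 5"
    using dim_strict[of 3 4 S] dim_strict[of 4 5 S] u by simp_all
  have d5: "?d 5 \<le> 8" using dim_subset[of "word_span S 5" UNIV] dim_UNIV by simp
  obtain B where B: "B \<subseteq> S" "independent B" "span B = span S" "card B = ?d 1"
    using basis_exists[of S] word_span_one[of S]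
    by (metis dim_span span_minimal span_mono subspace_span subset_antisym)
  have word_span_B: "word_span S k = word_span B k" for k by (rule word_span_cong) (simp add: B)
  \<comment> \<open>A single letter \<open>a\<close> yields nothing new beyond \<open>a \<star> a\<close>.\<close>
  have "2 \<le> card B"
  proof (rule ccontr)
    assume "\<not> 2 \<le> card B"
    have "finite B" using B finiteI_independent by blast
    with \<open>\<not> 2 \<le> card B\<close> obtain a where a: "B \<subseteq> {a}"
      by (metis card_1_singletonE card_0_eq empty_subsetI less_2_cases not_le order_refl One_nat_def)
    have "word_span B 2 \<subseteq> span ({a, a \<star> a})"
      unfolding word_span_two by (rule span_mono) (use a in blast)
    then have "?d 2 \<le> card {a, a \<star> a}" unfolding word_span_B by (intro dim_le_card) auto
    also have "\<dots> \<le> 2" by (simp add: card_insert_if)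
    finally have "?d 1 = 0" using d2 by linarith
    then have "card B = 0" by (simp only: B(4))
    then have "B = {}" using \<open>finite B\<close> by simp
    then have "word_span S 2 \<subseteq> {0}" unfolding word_span_B unfolding word_span_two by simp
    then have "?d 2 = 0" by (simp only: dim_eq_0)
    then show False using d2 by linarith
  qed
  then have "card B = 2" using B(4) d2 d3 d4 d5 by linarith
  then obtain a b where ab: "B = {a, b}" by (auto simp: card_2_iff)
  have "?d 4 \<le> ?d 3 + 1" using \<open>2 \<le> card B\<close> B(4) d2 d3 d4 d5 by linarith
  then have "word_span {a, b} 5 \<subseteq> word_span {a, b} 4"
    using step_if_small[of 3 4 B] unfolding word_span_B ab by (intro length_five_stable_two_letters) simp
  then show False using u(4) unfolding word_span_B ab by simp
qed

lemma set_length_le_four: "generating S \<Longrightarrow> set_length S \<le> 4"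
  using word_span_four word_span_le_set_length by (simp add: generating_def)

lemma algebra_length_eq_four:
  assumes "generating S" "word_span S 3 \<noteq> UNIV"
  shows "algebra_length = 4"
proof -
  have "set_length S = 4"
    using set_length_le_four[OF assms(1)] set_length_gt[OF assms word_span_four[OF assms(1)]] by simp
  then have mem: "4 \<in> {set_length S | S. generating S}" using assms(1) by force
  have le: "{set_length S | S. generating S} \<subseteq> {..4}" using set_length_le_four by auto
  show ?thesis
    unfolding algebra_length_def
    by (rule Max_eqI) (use mem le finite_subset[OF le] in auto)
qed

lemma algebra_length_eq_fourI:
  assumes "\<And>B. subspace B \<Longrightarrow> (\<And>x y. x \<in> B \<Longrightarrow> y \<in> B \<Longrightarrow> x \<star> y \<in> B) \<Longrightarrow> S \<subseteq> B \<Longrightarrow> B = UNIV"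
    and "word_span S 3 \<subseteq> span T" "finite T" "card T < 8"
  shows "algebra_length = 4"
proof (rule algebra_length_eq_four[OF generatingI[OF assms(1)]])
  have "dim (word_span S 3) \<le> card T" using assms(2,3) by (rule dim_le_card)
  then show "word_span S 3 \<noteq> UNIV" using assms(4) dim_UNIV by auto
qed

end

section \<open>Pairs of isotropic elements with nonzero cubic form\<close>

context vector_space
begin

text \<open>Linear maps that are proportional at every vector are proportional: compare the factors at
  \<open>x\<close>, \<open>x\<^sub>0\<close> and \<open>x + x\<^sub>0\<close>. With \<open>T\<close> the identity, a map for which every vector is an eigenvector is
  a scalar.\<close>

lemma pointwise_proportional:
  assumes U: "subspace U"
    and D: "\<And>x y. x \<in> U \<Longrightarrow> y \<in> U \<Longrightarrow> D (x + y) = D x + D y"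
      "\<And>c x. x \<in> U \<Longrightarrow> D (scale c x) = scale c (D x)"
    and T: "\<And>x y. x \<in> U \<Longrightarrow> y \<in> U \<Longrightarrow> T (x + y) = T x + T y"
      "\<And>c x. x \<in> U \<Longrightarrow> T (scale c x) = scale c (T x)"
    and T_inj: "\<And>x. x \<in> U \<Longrightarrow> T x = 0 \<Longrightarrow> x = 0"
    and proportional: "\<And>x. x \<in> U \<Longrightarrow> D x \<in> span {T x}"
  shows "\<exists>k. \<forall>x\<in>U. D x = scale k (T x)"
proof (cases "\<exists>x0\<in>U. x0 \<noteq> 0")
  case False
  then show ?thesis using D(2)[of 0 0] T(2)[of 0 0] by (intro exI[of _ 0]) auto
next
  case True
  then obtain x0 where x0: "x0 \<in> U" "x0 \<noteq> 0" by blast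
  have ex: "\<exists>k. D x = scale k (T x)" if "x \<in> U" for x
    using proportional[OF that] by (auto simp: span_singleton)
  from ex[OF x0(1)] obtain k0 where k0: "D x0 = scale k0 (T x0)" ..
  have Tx0: "T x0 \<noteq> 0" using T_inj x0 by blast
  have "D x = scale k0 (T x)" if x: "x \<in> U" for x
  proof (cases "\<exists>c. T x = scale c (T x0)")
    case True
    then obtain c where c: "T x = scale c (T x0)" ..
    have cx0: "scale (- c) x0 \<in> U" using U x0 by (simp add: subspace_scale subspace_neg)
    have "T (x + scale (- c) x0) = 0" using T(1)[OF x cx0] unfolding T(2)[OF x0(1)] c by simp
    then have "x + scale (- c) x0 = 0" using T_inj[OF subspace_add[OF U x cx0]] by blast
    then have "x = scale c x0" by simp
    then show ?thesis using D(2)[OF x0(1)] T(2)[OF x0(1)] k0 by (simp add: mult.commute)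
  next
    case False
    obtain k where k: "D x = scale k (T x)" using ex[OF x] ..
    obtain m where m: "D (x + x0) = scale m (T (x + x0))" using ex[OF subspace_add[OF U x x0(1)]] ..
    have eq: "scale k (T x) + scale k0 (T x0) = scale m (T x) + scale m (T x0)"
      using m unfolding D(1)[OF x x0(1)] T(1)[OF x x0(1)] k k0 by (simp add: scale_right_distrib)
    then have eq: "scale (k - m) (T x) = scale (m - k0) (T x0)"
      by (simp add: scale_left_diff_distrib algebra_simps)
    have "k = m"
    proof (rule ccontr)
      assume "k \<noteq> m"
      then have "T x = scale (inverse (k - m)) (scale (k - m) (T x))" by simp
      then show False using False unfolding eq by (metis scale_scale)
    qed
    then have "m = k0" using eq Tx0 by simp
    then show ?thesis using k \<open>k = m\<close> by simp
  qed
  then show ?thesis by blast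
qed

end

context eight_dim_symmetric_composition
begin

lemma opposite_eight_dim: "eight_dim_symmetric_composition scale (\<lambda>x y. y \<star> x) n Basis"
proof -
  interpret op: symmetric_composition scale "\<lambda>x y. y \<star> x" n by (rule opposite)
  show ?thesis
    by unfold_locales (auto simp: card_Basis intro: polar_nondegenerate commuting_eq_zero)
qed

text \<open>Nondegeneracy separates a vector from a finite-dimensional subspace. By induction, for a new
  vector \<open>w\<close> outside \<open>span M\<close> a functional for \<open>w\<close> is used to correct one for a modified \<open>x\<close>.\<close>

lemma polar_separation:
  assumes "finite M" "x \<notin> span M"
  shows "\<exists>y. polar y x \<noteq> 0 \<and> (\<forall>w\<in>M. polar y w = 0)"
  using assms
proof (induction M arbitrary: x rule: finite_induct)
  case empty
  then have "x \<noteq> 0" by auto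
  then obtain y where "polar x y \<noteq> 0" using polar_nondegenerate by blast
  then show ?case by (auto simp: polar_commute intro!: exI[of _ y])
next
  case (insert w M)
  show ?case
  proof (cases "w \<in> span M")
    case True
    then have "x \<notin> span M" using insert.prems by (simp add: span_redundant)
    then obtain y where y: "polar y x \<noteq> 0" "\<forall>w\<in>M. polar y w = 0" using insert.IH by blast
    have "subspace {w. polar y w = 0}" by (auto simp: subspace_def polar_linear)
    then have "span M \<subseteq> {w. polar y w = 0}" using y(2) by (intro span_minimal) auto
    then show ?thesis using True y by blast
  next
    case False
    then obtain y2 where y2: "polar y2 w \<noteq> 0" "\<forall>v\<in>M. polar y2 v = 0" using insert.IH by blast
    define x' where "x' = x - (polar y2 x / polar y2 w) \<cdot> w"
    have "x' \<notin> span M"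
      using insert.prems unfolding x'_def span_breakdown_eq by blast
    then obtain y1 where y1: "polar y1 x' \<noteq> 0" "\<forall>v\<in>M. polar y1 v = 0" using insert.IH by blast
    define y where "y = y1 - (polar y1 w / polar y2 w) \<cdot> y2"
    have "polar y x = polar y1 x'" by (simp add: y_def x'_def polar_linear)
    moreover have "polar y w = 0" using y2 by (simp add: y_def polar_linear)
    moreover have "\<forall>v\<in>M. polar y v = 0" using y1 y2 by (simp add: y_def polar_linear)
    ultimately show ?thesis using y1 by (intro exI[of _ y]) simp
  qed
qed

lemma polar_self_zero: "n x = 0 \<Longrightarrow> polar x x = 0"
  by (simp add: polar_self)

text \<open>If \<open>b \<star> a\<close> were not a multiple of \<open>b\<close>, there would be \<open>y\<close> with \<open>polar y b \<noteq> 0\<close> and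
  \<open>polar y (b \<star> a) = 0\<close>. The element \<open>u = y \<star> b\<close> satisfies \<open>u \<star> b = polar y b \<cdot> b\<close>, because
  \<open>b \<star> b = 0\<close>, and it is orthogonal to \<open>a\<close>, which gives \<open>(u \<star> b) \<star> a = 0\<close>. So \<open>b \<star> a = 0\<close>.\<close>

lemma square_zero_eigenvector:
  assumes "a \<star> b = 0" "polar a b = 0" "b \<star> b = 0"
  shows "b \<star> a \<in> span {b}"
proof (rule ccontr)
  assume *: "b \<star> a \<notin> span {b}"
  then have ba: "b \<star> a \<noteq> 0" using span_zero by metis
  have "b \<notin> span {b \<star> a}"
  proof
    assume "b \<in> span {b \<star> a}"
    then obtain k where k: "b = k \<cdot> (b \<star> a)" by (auto simp: span_singleton)
    then have "k \<noteq> 0" using * ba by (metis mult_zero_left scale_zero_left)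
    then have "b \<star> a = inverse k \<cdot> b" using arg_cong[OF k, of "\<lambda>x. inverse k \<cdot> x"] by simp
    then show False using * by (metis span_base span_scale singletonI)
  qed
  then obtain y where y: "polar y b \<noteq> 0" "polar y (b \<star> a) = 0"
    using polar_separation[of "{b \<star> a}" b] by auto
  define u where "u = y \<star> b"
  have "u \<star> b = polar y b \<cdot> b" unfolding u_def swap_left[of y b b] by (simp add: assms)
  moreover have "(u \<star> b) \<star> a = 0"
    unfolding swap_left[of u b a] using assms y by (simp add: u_def polar_assoc)
  ultimately show False using y ba by (simp add: mult_linear)
qed

lemma square_zero_eigenvector_dual:
  assumes "b \<star> a = 0" "polar a b = 0" "b \<star> b = 0"
  shows "a \<star> b \<in> span {b}"
proof -
  interpret op: eight_dim_symmetric_composition scale "\<lambda>x y. y \<star> x" n Basis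
    by (rule opposite_eight_dim)
  show ?thesis using op.square_zero_eigenvector[where a = a and b = b] assms by blast
qed

text \<open>If \<open>cubic x = 0\<close>, then \<open>x \<star> x\<close> squares to zero, so that one may assume \<open>x \<star> x = 0\<close>. For any
  \<open>y\<close> with \<open>polar x y \<noteq> 0\<close>, the element \<open>y \<star> x\<close> is isotropic and its cubic form is
  \<open>- (polar x y)\<^sup>3\<close>.\<close>

lemma isotropic_cubic_nonzero:
  assumes "x \<noteq> 0" "n x = 0"
  shows "\<exists>a. n a = 0 \<and> cubic a \<noteq> 0"
proof -
  have square_zero: "\<exists>a. n a = 0 \<and> cubic a \<noteq> 0" if x: "x \<noteq> 0" "n x = 0" "x \<star> x = 0" for x
  proof -
    obtain y where y: "polar x y \<noteq> 0" using polar_nondegenerate x by blast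
    define u where "u = y \<star> x"
    have nu: "n u = 0" by (simp add: u_def n_mult x)
    have ux: "u \<star> x = polar x y \<cdot> x"
      unfolding u_def swap_left[of y x x] by (simp add: x polar_commute)
    have "polar u x = 0" by (simp add: u_def polar_assoc x)
    then have "x \<star> (u \<star> u) = - (u \<star> (u \<star> x))" unfolding swap_right[of x u u]
      by (simp add: polar_commute)
    then have xuu: "x \<star> (u \<star> u) = - ((polar x y)\<^sup>2 \<cdot> x)"
      by (simp add: ux mult_linear power2_eq_square)
    have "cubic u = polar y (x \<star> (u \<star> u))" unfolding cubic_def by (simp add: u_def polar_assoc)
    then have "cubic u = - (polar x y ^ 3)"
      unfolding xuu by (simp add: polar_linear polar_commute power2_eq_square power3_eq_cube)
    then show ?thesis using nu y by auto
  qed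
  show ?thesis
  proof (cases "cubic x = 0")
    case True
    show ?thesis
    proof (cases "x \<star> x = 0")
      case False
      have "(x \<star> x) \<star> (x \<star> x) = 0" using True assms by (simp add: square_square)
      then show ?thesis using square_zero[OF False] assms by (simp add: n_mult)
    qed (use square_zero assms in blast)
  qed (use assms in blast)
qed

text \<open>For isotropic \<open>a\<close> with \<open>cubic a \<noteq> 0\<close> the two conditions cut out two complementary subspaces
  of the orthogonal complement of \<open>span {a, a \<star> a}\<close>. If \<open>a\<close> is \<open>x\<^sub>1\<^sub>,\<^sub>0\<close> in the split algebra, they
  are spanned by the \<open>x\<^sub>i\<^sub>,\<^sub>1\<close> and by the \<open>x\<^sub>i\<^sub>,\<^sub>-\<^sub>1\<close>.\<close>

definition right_annihilated :: "'v \<Rightarrow> 'v \<Rightarrow> bool" where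
  "right_annihilated a x \<longleftrightarrow> a \<star> x = 0 \<and> polar a x = 0"

definition left_annihilated :: "'v \<Rightarrow> 'v \<Rightarrow> bool" where
  "left_annihilated a x \<longleftrightarrow> x \<star> a = 0 \<and> polar a x = 0"

end

locale isotropic_element = eight_dim_symmetric_composition scale mult n Basis
  for scale :: "'a::field \<Rightarrow> 'v::ab_group_add \<Rightarrow> 'v" (infixr \<open>\<cdot>\<close> 75)
    and mult :: "'v \<Rightarrow> 'v \<Rightarrow> 'v" (infixl \<open>\<star>\<close> 70) and n and Basis +
  fixes a :: 'v
  assumes n_a: "n a = 0" and cubic_a: "cubic a \<noteq> 0"
begin

definition a2 :: 'v where "a2 = a \<star> a"

abbreviation (input) \<alpha> :: 'a where "\<alpha> \<equiv> cubic a"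

abbreviation plus_part :: "'v \<Rightarrow> bool" where "plus_part \<equiv> right_annihilated a"

abbreviation minus_part :: "'v \<Rightarrow> bool" where "minus_part \<equiv> left_annihilated a"

lemmas part_defs = right_annihilated_def left_annihilated_def

lemma a_nonzero: "a \<noteq> 0"
  using cubic_a by (auto simp: cubic_def)

lemma a_products [simp]: "a \<star> a2 = 0" "a2 \<star> a = 0" "a2 \<star> a2 = \<alpha> \<cdot> a"
  using comp_left[of a a] comp_right[of a a] square_square[of a] by (simp_all add: a2_def n_a)

lemma a_polars [simp]: "polar a a = 0" "polar a2 a2 = 0" "polar a a2 = \<alpha>" "polar a2 a = \<alpha>"
  "n a2 = 0"
  by (simp_all add: polar_self n_a a2_def n_mult cubic_def polar_commute[of "a \<star> a" a])

lemma cubic_a2: "cubic a2 = \<alpha>\<^sup>2"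
  by (simp add: cubic_def[of a2] polar_linear power2_eq_square)

text \<open>Right multiplication by \<open>a\<close> acts on this part, and its cube is \<open>- \<alpha>\<close>.\<close>

lemma plus_products:
  assumes "plus_part x"
  shows "a \<star> x = 0" "polar a x = 0" "polar x a = 0" "n x = 0" "x \<star> a2 = 0"
    "a2 \<star> x = - ((x \<star> a) \<star> a)" "((x \<star> a) \<star> a) \<star> a = - (\<alpha> \<cdot> x)"
    "plus_part (x \<star> a)" "polar x a2 = 0" "polar a2 x = 0" "a \<star> (x \<star> a) = 0"
    "(x \<star> a) \<star> x = 0" "a \<star> (x \<star> x) = - (x \<star> (x \<star> a))"
proof -
  show 1: "a \<star> x = 0" and 2: "polar a x = 0" and 3: "polar x a = 0"
    using assms by (simp_all add: part_defs polar_commute)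
  have "n x \<cdot> a = 0" using comp_right[of x a] 1 by simp
  then show 4: "n x = 0" using a_nonzero by simp
  show "x \<star> a2 = 0" unfolding a2_def swap_right[of x a a] by (simp add: 1 3)
  show 5: "a2 \<star> x = - ((x \<star> a) \<star> a)" unfolding a2_def swap_left[of a a x] by (simp add: 2)
  then have "((x \<star> a) \<star> a) = - (a2 \<star> x)" by simp
  then show "((x \<star> a) \<star> a) \<star> a = - (\<alpha> \<cdot> x)"
    using swap_left[of a2 x a] by (simp add: mult_linear 1)
  show 6: "polar a2 x = 0" by (simp add: a2_def polar_assoc 1)
  then show "polar x a2 = 0" by (simp add: polar_commute)
  show 7: "a \<star> (x \<star> a) = 0" by (simp add: comp_right n_a)
  have "polar a (x \<star> a) = 0" using 6 by (metis a2_def polar_assoc polar_commute)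
  with 7 show "plus_part (x \<star> a)" by (simp add: part_defs)
  show "(x \<star> a) \<star> x = 0" by (simp add: comp_left 4)
  show "a \<star> (x \<star> x) = - (x \<star> (x \<star> a))" unfolding swap_right[of a x x] by (simp add: 2)
qed

text \<open>Here it is left multiplication by \<open>a\<close> whose cube is \<open>- \<alpha>\<close>.\<close>

lemma minus_products:
  assumes "minus_part z"
  shows "z \<star> a = 0" "polar a z = 0" "polar z a = 0" "a2 \<star> z = 0" "z \<star> a2 = - (a \<star> (a \<star> z))"
    "a \<star> (a \<star> (a \<star> z)) = - (\<alpha> \<cdot> z)" "minus_part (a \<star> z)" "polar z a2 = 0" "polar a2 z = 0"
    "a \<star> (z \<star> a2) = \<alpha> \<cdot> z"
proof -
  show 1: "z \<star> a = 0" and 2: "polar a z = 0" and 3: "polar z a = 0"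
    using assms by (simp_all add: part_defs polar_commute)
  show "a2 \<star> z = 0" unfolding a2_def swap_left[of a a z] by (simp add: 1 2)
  show 5: "z \<star> a2 = - (a \<star> (a \<star> z))" unfolding a2_def swap_right[of z a a] by (simp add: 3)
  show 8: "a \<star> (z \<star> a2) = \<alpha> \<cdot> z" unfolding swap_right[of a z a2] by (simp add: 1)
  then show "a \<star> (a \<star> (a \<star> z)) = - (\<alpha> \<cdot> z)" unfolding 5 by (simp add: mult_linear minus_equation_iff)
  show 6: "polar z a2 = 0" unfolding a2_def polar_assoc[symmetric] by (simp add: 1)
  then show "polar a2 z = 0" by (simp add: polar_commute)
  have "(a \<star> z) \<star> a = 0" by (simp add: comp_left n_a)
  moreover have "polar a (a \<star> z) = 0" using 6
    by (metis a2_def polar_assoc polar_commute)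
  ultimately show "minus_part (a \<star> z)" by (simp add: part_defs)
qed

lemma square_of_plus:
  assumes "plus_part x"
  shows "minus_part (x \<star> x)"
proof -
  note px = plus_products(1,3)[OF assms]
  have "(x \<star> x) \<star> a = 0" unfolding swap_left[of x x a] by (simp add: px)
  moreover have "polar a (x \<star> x) = 0" unfolding polar_assoc[symmetric] by (simp add: px)
  ultimately show ?thesis by (simp add: part_defs)
qed

text \<open>For \<open>w\<close> orthogonal to \<open>a\<close> and \<open>a2\<close>, the polarised identity
  \<open>\<alpha> \<cdot> w = a2 \<star> (w \<star> a) + a \<star> (w \<star> a2)\<close> is already the decomposition.\<close>

lemma decomposition:
  obtains s t p q where "plus_part p" "minus_part q" "v = s \<cdot> a + t \<cdot> a2 + p + q"
    "s = polar v a2 / \<alpha>" "t = polar v a / \<alpha>"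
proof -
  define w where "w = v - (polar v a2 / \<alpha>) \<cdot> a - (polar v a / \<alpha>) \<cdot> a2"
  have wa: "polar w a = 0" "polar w a2 = 0" using cubic_a by (simp_all add: w_def polar_linear)
  have p: "plus_part (a2 \<star> (w \<star> a))"
  proof -
    have "polar a (w \<star> a) = 0" using wa(2) by (metis a2_def polar_assoc polar_commute)
    then have "a \<star> (a2 \<star> (w \<star> a)) = 0" unfolding swap_right[of a a2 "w \<star> a"] by simp
    moreover have "polar a (a2 \<star> (w \<star> a)) = 0" by (simp add: polar_assoc[symmetric])
    ultimately show ?thesis by (simp add: part_defs)
  qed
  have q: "minus_part (a \<star> (w \<star> a2))"
  proof -
    have "polar a (a \<star> (w \<star> a2)) = polar (w \<star> a2) a2"
      by (metis a2_def polar_assoc polar_commute)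
    also have "\<dots> = 0" using wa by (simp add: polar_assoc polar_linear)
    finally show ?thesis by (simp add: part_defs comp_left n_a)
  qed
  have "\<alpha> \<cdot> w = a2 \<star> (w \<star> a) + a \<star> (w \<star> a2)" using swap_right[of a w a2] by simp
  then have "w = inverse \<alpha> \<cdot> (a2 \<star> (w \<star> a)) + inverse \<alpha> \<cdot> (a \<star> (w \<star> a2))"
    using cubic_a by (metis scale_left_imp_eq scale_one scale_right_distrib scale_scale right_inverse)
  moreover have "plus_part (inverse \<alpha> \<cdot> (a2 \<star> (w \<star> a)))" "minus_part (inverse \<alpha> \<cdot> (a \<star> (w \<star> a2)))"
    using p q by (simp_all add: part_defs mult_linear polar_linear)
  moreover have "v = (polar v a2 / \<alpha>) \<cdot> a + (polar v a / \<alpha>) \<cdot> a2 + w" by (simp add: w_def)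
  ultimately show ?thesis using that by (metis add.assoc)
qed

lemma minus_perp_minus:
  assumes "minus_part z" "minus_part q"
  shows "polar z q = 0"
proof -
  have "\<alpha> * polar z q = polar (a \<star> (z \<star> a2)) q"
    by (simp add: minus_products(10)[OF assms(1)] polar_linear)
  also have "\<dots> = 0" by (simp add: polar_rotate minus_products[OF assms(2)])
  finally show ?thesis using cubic_a by simp
qed

text \<open>The minus part is totally isotropic and orthogonal to \<open>a\<close> and \<open>a2\<close>, so nondegeneracy pairs it
  faithfully with the plus part.\<close>

lemma minus_eq_zeroI:
  assumes z: "minus_part z" and plus: "\<And>x. plus_part x \<Longrightarrow> polar z x = 0"
  shows "z = 0"
proof (rule polar_nondegenerate)
  fix v
  obtain s t p q where "plus_part p" "minus_part q" and v: "v = s \<cdot> a + t \<cdot> a2 + p + q"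
    by (rule decomposition)
  then show "polar z v = 0"
    unfolding v by (simp add: polar_linear plus minus_perp_minus z minus_products[OF z])
qed

text \<open>If right multiplication by \<open>a\<close> were a scalar \<open>k\<close> on the plus part, then by duality left
  multiplication would be \<open>k\<close> on the minus part. The nonzero element \<open>a2 - k \<cdot> a\<close> would then
  commute with everything.\<close>

lemma plus_not_scalar: "\<exists>x. plus_part x \<and> x \<star> a \<notin> span {x}"
proof (rule ccontr)
  assume "\<not> ?thesis"
  then have eigen: "\<And>x. plus_part x \<Longrightarrow> x \<star> a \<in> span {x}" by blast
  have "subspace {x. plus_part x}" by (auto simp: subspace_def part_defs mult_linear polar_linear)
  then obtain k where k: "\<And>x. plus_part x \<Longrightarrow> x \<star> a = k \<cdot> x"
    using pointwise_proportional[of "{x. plus_part x}" "\<lambda>x. x \<star> a" "\<lambda>x. x"] eigen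
    by (auto simp: mult_linear)
  have k': "a \<star> u = k \<cdot> u" if u: "minus_part u" for u
  proof -
    note mu = minus_products[OF u]
    have "minus_part (a \<star> u - k \<cdot> u)"
      using mu(7) u by (simp add: part_defs mult_linear polar_linear)
    moreover have "polar (a \<star> u - k \<cdot> u) x = 0" if "plus_part x" for x
      using k[OF that] by (simp add: polar_linear polar_rotate)
    ultimately have "a \<star> u - k \<cdot> u = 0" by (rule minus_eq_zeroI)
    then show ?thesis by simp
  qed
  define c where "c = a2 - k \<cdot> a"
  have "c = 0"
  proof (rule commuting_eq_zero)
    fix v
    obtain s t p q where p: "plus_part p" and q: "minus_part q"
      and v: "v = s \<cdot> a + t \<cdot> a2 + p + q"
      by (rule decomposition)
    have "c \<star> p = p \<star> c" "c \<star> q = q \<star> c"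
      using k[OF p] k'[OF q] plus_products(1,5,6)[OF p] minus_products(1,4,5)[OF q]
      by (simp_all add: c_def mult_linear)
    moreover have "c \<star> a = a \<star> c" "c \<star> a2 = a2 \<star> c" by (simp_all add: c_def mult_linear)
    ultimately show "c \<star> v = v \<star> c" unfolding v by (simp add: mult_linear)
  qed
  then have "polar a c = 0" by simp
  then show False using cubic_a by (simp add: c_def polar_linear)
qed

lemma plus_square_nonzero:
  assumes "plus_part x" "x \<star> a \<notin> span {x}"
  shows "x \<star> x \<noteq> 0"
  using square_zero_eigenvector[of a x] assms by (auto simp: part_defs)

text \<open>Suppose that \<open>cubic\<close> vanishes on the plus part and take \<open>b\<close> there that is not an eigenvector.
  Then \<open>z = b \<star> b\<close> is a nonzero element of the minus part with \<open>z \<star> z = 0\<close>, so \<open>a \<star> z = k \<cdot> z\<close>.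
  For every \<open>c\<close> in the plus part, \<open>y = k\<^sup>2 \<cdot> c + k \<cdot> (c \<star> a) + (c \<star> a) \<star> a\<close> is an eigenvector of
  right multiplication, whence \<open>y \<star> y = 0\<close>. Polarising \<open>cubic\<close> at \<open>b + y\<close> gives
  \<open>3 * polar z y = 0\<close>, and \<open>polar z y = 3 * k\<^sup>2 * polar z c\<close>. So \<open>z\<close> is orthogonal to the plus part,
  hence \<open>z = 0\<close>.\<close>

lemma cubic_nonzero_plus:
  assumes three: "(3::'a) \<noteq> 0"
  shows "\<exists>b. plus_part b \<and> cubic b \<noteq> 0"
proof (rule ccontr)
  assume "\<not> ?thesis"
  then have cubic_zero: "\<And>x. plus_part x \<Longrightarrow> cubic x = 0" by blast
  obtain b where b: "plus_part b" "b \<star> a \<notin> span {b}" using plus_not_scalar by blast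
  define z where "z = b \<star> b"
  have z: "minus_part z" "z \<noteq> 0"
    using square_of_plus plus_square_nonzero b by (simp_all add: z_def)
  note mz = minus_products[OF z(1)]
  have "z \<star> z = 0"
    using square_square[of b] cubic_zero[OF b(1)] plus_products(4)[OF b(1)] by (simp add: z_def)
  then have "a \<star> z \<in> span {z}" using z(1) by (intro square_zero_eigenvector_dual) (auto simp: part_defs)
  then obtain k where k: "a \<star> z = k \<cdot> z" by (auto simp: span_singleton)
  have k3: "k ^ 3 = - \<alpha>"
  proof -
    have "(k ^ 3) \<cdot> z = (- \<alpha>) \<cdot> z" using mz(6) by (simp add: k mult_linear power3_eq_cube)
    then show ?thesis using z(2) by (simp only: scale_cancel_right) simp
  qed
  then have "k \<noteq> 0" using cubic_a by auto
  have "polar z c = 0" if c: "plus_part c" for c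
  proof -
    define y where "y = k\<^sup>2 \<cdot> c + k \<cdot> (c \<star> a) + (c \<star> a) \<star> a"
    note pc = plus_products[OF c] and pca = plus_products[OF plus_products(8)[OF c]]
    have "plus_part y" using c pc(8) pca(8)
      by (simp add: y_def part_defs mult_linear polar_linear)
    have "y \<star> a = k \<cdot> y"
    proof -
      have "- \<alpha> = k * k\<^sup>2" using k3 by (simp add: power3_eq_cube power2_eq_square mult.assoc)
      then have "- (\<alpha> \<cdot> c) = (k * k\<^sup>2) \<cdot> c" by (simp flip: scale_minus_left)
      then show ?thesis unfolding y_def by (simp add: mult_linear pc(7) scale_right_distrib power2_eq_square)
    qed
    then have "k \<cdot> (y \<star> y) = 0" using plus_products(12)[OF \<open>plus_part y\<close>] by (simp add: mult_linear)
    then have yy: "y \<star> y = 0" using \<open>k \<noteq> 0\<close> by simp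
    have "plus_part (b + y)" using b(1) \<open>plus_part y\<close> by (simp add: part_defs mult_linear polar_linear)
    then have "3 * polar z y = 0"
      using cubic_add[of b y] cubic_zero b(1) \<open>plus_part y\<close> yy by (simp add: z_def)
    then have zy: "polar z y = 0" using three by simp
    have shift: "polar z (x \<star> a) = k * polar z x" for x
      using polar_rotate[of a z x] by (simp add: k polar_linear)
    have "polar z y = 3 * k\<^sup>2 * polar z c"
      by (simp add: y_def polar_linear shift power2_eq_square)
    then show ?thesis using zy three \<open>k \<noteq> 0\<close> by simp
  qed
  then show False using minus_eq_zeroI z by blast
qed

end

context eight_dim_symmetric_composition
begin

text \<open>Now \<open>cubic\<close> is additive. If it vanishes on both parts, it only sees the components along \<open>a\<close>
  and \<open>a2\<close>. Then \<open>a' = a + u\<close>, with \<open>u\<close> in the plus part and not an eigenvector, still has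
  \<open>cubic a' = cubic a\<close>, and for \<open>v\<close> orthogonal to \<open>a'\<close> and \<open>a' \<star> a'\<close> the element
  \<open>b = (a' \<star> a') \<star> (v \<star> a')\<close> is annihilated by \<open>a'\<close>. Its components along \<open>a\<close> and \<open>a2\<close> are
  governed by \<open>polar b a2 = 0\<close> and \<open>polar b a = polar v (a \<star> (a \<star> (u \<star> u)))\<close>, so \<open>v\<close> only has to be
  chosen with the latter nonzero.\<close>

lemma cubic_pair_char_three:
  assumes three: "(3::'a) = 0" and a: "n a = 0" "cubic a \<noteq> 0"
  shows "\<exists>a b. n a = 0 \<and> cubic a \<noteq> 0 \<and> right_annihilated a b \<and> cubic b \<noteq> 0"
proof -
  interpret isotropic_element scale mult n Basis a by unfold_locales (use a in auto)
  have cubic_additive: "cubic (x + y) = cubic x + cubic y" for x y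
    by (simp add: cubic_add three)
  consider b where "plus_part b" "cubic b \<noteq> 0" | b where "minus_part b" "cubic b \<noteq> 0"
    | "\<And>x. plus_part x \<Longrightarrow> cubic x = 0" "\<And>x. minus_part x \<Longrightarrow> cubic x = 0" by blast
  then show ?thesis
  proof cases
    case 1
    then show ?thesis using a by blast
  next
    case 2
    \<comment> \<open>The pair is \<open>(b, a)\<close>, in this order.\<close>
    have "n b \<cdot> a = 0" using comp_left[of b a] 2(1) by (simp add: part_defs)
    then have "n b = 0" using a_nonzero by simp
    moreover have "right_annihilated b a" using 2(1) by (simp add: part_defs polar_commute)
    ultimately show ?thesis using 2(2) a by blast
  next
    case 3
    obtain u where u: "plus_part u" "u \<star> a \<notin> span {u}" using plus_not_scalar by blast
    define z where "z = u \<star> u"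
    have z: "minus_part z" "z \<noteq> 0"
      using square_of_plus plus_square_nonzero u by (simp_all add: z_def)
    note mz = minus_products[OF z(1)] and pu = plus_products[OF u(1)]
    note maz = minus_products[OF mz(7)]
    define a' where "a' = a + u"
    define a2' where "a2' = a' \<star> a'"
    have a2': "a2' = a2 + u \<star> a + z" by (simp add: a2'_def a'_def mult_linear pu a2_def z_def)
    have na': "n a' = 0" by (simp add: a'_def n_add a pu)
    have ga': "cubic a' = \<alpha>" by (simp add: a'_def cubic_additive 3 u)
    have uaz: "u \<star> (a \<star> z) = 0"
      unfolding z_def swap_right[of u a "u \<star> u"] using 3(1)[OF u(1)] by (simp add: pu cubic_def)
    have ca: "a' \<star> (a \<star> a2') = a \<star> (a \<star> z)"
      by (simp add: a2' a'_def mult_linear pu uaz)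
    have "a2 \<star> (u \<star> a) = \<alpha> \<cdot> u" unfolding swap_right[of a2 u a] by (simp add: pu)
    then have "a2 \<star> a2' = \<alpha> \<cdot> a'"
      by (simp add: a2' a'_def mult_linear mz scale_right_distrib)
    then have ca2: "a' \<star> (a2 \<star> a2') = \<alpha> \<cdot> a2'" by (simp add: mult_linear a2'_def)
    have "a \<star> (a \<star> z) \<notin> span {a', a2'}"
    proof
      assume "a \<star> (a \<star> z) \<in> span {a', a2'}"
      then obtain s t where st: "a \<star> (a \<star> z) = s \<cdot> a' + t \<cdot> a2'"
        by (auto simp: span_insert span_singleton algebra_simps)
      have "polar (a \<star> (a \<star> z)) a2 = s * \<alpha>" "polar (a \<star> (a \<star> z)) a = t * \<alpha>"
        unfolding st by (simp_all add: a'_def a2' polar_linear pu mz plus_products[OF pu(8)])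
      then have "s = 0" "t = 0" using minus_products(3,8)[OF maz(7)] cubic_a by simp_all
      then have "a \<star> (a \<star> z) = 0" using st by simp
      then have "\<alpha> \<cdot> z = 0" using mz(6) by simp
      then show False using z(2) cubic_a by simp
    qed
    then obtain v where v: "polar v (a \<star> (a \<star> z)) \<noteq> 0" "polar v a' = 0" "polar v a2' = 0"
      using polar_separation[of "{a', a2'}" "a \<star> (a \<star> z)"] by auto
    define b where "b = a2' \<star> (v \<star> a')"
    have "a2' \<star> a' = 0" "a' \<star> a2' = 0" by (simp_all add: a2'_def comp_left comp_right na')
    moreover have "polar a' (v \<star> a') = 0"
      using v(3) by (metis a2'_def polar_assoc polar_commute)
    ultimately have "right_annihilated a' b"
      using swap_right[of a' a2' "v \<star> a'"]
      by (simp add: b_def right_annihilated_def polar_assoc[symmetric])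
    moreover have pol_b: "polar b x = polar v (a' \<star> (x \<star> a2'))" for x
      by (metis b_def polar_assoc polar_commute)
    have "cubic b \<noteq> 0"
    proof -
      obtain s t p q where pq: "plus_part p" "minus_part q"
        and b: "b = s \<cdot> a + t \<cdot> a2 + p + q" "s = polar b a2 / \<alpha>" "t = polar b a / \<alpha>"
        by (rule decomposition)
      have "polar b a2 = 0" using v by (simp add: pol_b ca2 polar_linear)
      moreover have "polar b a \<noteq> 0" using v by (simp add: pol_b ca)
      ultimately have "s = 0" "t \<noteq> 0" using b(2,3) cubic_a by simp_all
      then show ?thesis
        using 3(1)[OF pq(1)] 3(2)[OF pq(2)] cubic_a unfolding b(1)
        by (simp add: cubic_additive cubic_scale cubic_a2)
    qed
    ultimately show ?thesis using na' ga' cubic_a by (intro exI[of _ a'] exI[of _ b]) simp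
  qed
qed

lemma cubic_pair:
  assumes "x \<noteq> 0" "n x = 0"
  shows "\<exists>a b. n a = 0 \<and> cubic a \<noteq> 0 \<and> right_annihilated a b \<and> cubic b \<noteq> 0"
proof -
  obtain a where a: "n a = 0" "cubic a \<noteq> 0" using isotropic_cubic_nonzero assms by blast
  show ?thesis
  proof (cases "(3::'a) = 0")
    case False
    interpret isotropic_element scale mult n Basis a by unfold_locales (use a in auto)
    show ?thesis using cubic_nonzero_plus[OF False] a by blast
  qed (use cubic_pair_char_three a in blast)
qed

end

section \<open>The isotropic case\<close>

context eight_dim_symmetric_composition
begin

lemma polar_sum: "polar (sum f M) z = (\<Sum>i\<in>M. polar (f i) z)"
  by (induction M rule: infinite_finite_induct) (simp_all add: polar_add_left)

text \<open>A dual family for the polar form makes the vectors independent, and eight independent vectors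
  span.\<close>

lemma span_of_dual_family:
  assumes "length us = 8"
    and dual: "\<And>i j. i < 8 \<Longrightarrow> j < 8 \<Longrightarrow> polar (us ! i) (ws ! j) = 0 \<longleftrightarrow> i \<noteq> j"
  shows "span (set us) = UNIV"
proof -
  have distinct: "distinct us"
    unfolding distinct_conv_nth using assms(1) dual by metis
  have "independent (set us)"
    unfolding independent_explicit_module
  proof (intro allI impI)
    fix M u v assume M: "finite M" "M \<subseteq> set us" "(\<Sum>v\<in>M. u v \<cdot> v) = 0" "v \<in> M"
    obtain i where i: "i < 8" "v = us ! i" using M assms(1) by (metis in_set_conv_nth subsetD)
    have "0 = (\<Sum>w\<in>M. u w * polar w (ws ! i))"
      using arg_cong[OF M(3), of "\<lambda>x. polar x (ws ! i)"] by (simp add: polar_sum polar_linear)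
    also have "\<dots> = (\<Sum>w\<in>M. if w = v then u v * polar v (ws ! i) else 0)"
    proof (rule sum.cong[OF refl])
      fix w assume "w \<in> M"
      then obtain j where j: "j < 8" "w = us ! j" using M assms(1) by (metis in_set_conv_nth subsetD)
      show "u w * polar w (ws ! i) = (if w = v then u v * polar v (ws ! i) else 0)"
        using dual[OF j(1) i(1)] i j by auto
    qed
    also have "\<dots> = u v * polar v (ws ! i)" using M by simp
    finally show "u v = 0" using dual[OF i(1) i(1)] i by simp
  qed
  moreover have "card (set us) = 8" using distinct assms(1) by (simp add: distinct_card)
  ultimately show ?thesis
    using card_ge_dim_independent[of "set us" UNIV] dim_UNIV by auto
qed

end

context isotropic_element
begin

text \<open>The eight elements \<open>a\<close>, \<open>a \<star> a\<close>, \<open>b\<close>, \<open>b \<star> b\<close>, \<open>b \<star> a\<close>, \<open>(b \<star> b) \<star> (a \<star> a)\<close>,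
  \<open>a \<star> (b \<star> b)\<close>, \<open>(a \<star> a) \<star> b\<close> multiply, up to scalars, like the basis of the split algebra. For
  the polar form consecutive ones pair to \<open>cubic a\<close>, \<open>cubic b\<close>, \<open>cubic a * cubic b\<close> and
  \<open>cubic a * cubic b\<close>, and all other pairings are zero.\<close>

lemma generated_by_cubic_pair:
  assumes b: "plus_part b" "cubic b \<noteq> 0"
    and B: "subspace B" "\<And>x y. x \<in> B \<Longrightarrow> y \<in> B \<Longrightarrow> x \<star> y \<in> B" "a \<in> B" "b \<in> B"
  shows "B = UNIV"
proof -
  note pb = plus_products[OF b(1)]
  interpret b: isotropic_element scale mult n Basis b
    by unfold_locales (use b pb in auto)
  let ?b2 = "b.a2"
  have b2: "?b2 = b \<star> b" by (rule b.a2_def)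
  have minus_b2: "minus_part ?b2" unfolding b2 by (rule square_of_plus[OF b(1)])
  note mb2 = minus_products[OF minus_b2]
  define c d c' d' where "c = b \<star> a" and "d = a \<star> ?b2" and "c' = ?b2 \<star> a2" and "d' = a2 \<star> b"
  have plus_c: "plus_part c" unfolding c_def by (rule pb)
  have minus_d: "minus_part d" unfolding d_def by (rule mb2)
  have plus_d': "plus_part d'"
    using plus_products(8)[OF pb(8)] unfolding d'_def pb(6)
    by (simp add: part_defs mult_linear polar_linear)
  have n_zero: "n c = 0" "n d = 0" "n c' = 0" "n d' = 0"
    using pb(4) by (simp_all add: c_def d_def c'_def d'_def n_mult n_a)
  have ad: "a \<star> d = - c'" using mb2(5) by (simp add: d_def c'_def)
  have ac': "a \<star> c' = cubic a \<cdot> ?b2" unfolding c'_def by (rule mb2)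
  have d'b2: "d' \<star> ?b2 = 0"
    unfolding d'_def swap_left[of a2 b ?b2] using mb2(9) by simp
  have b2d': "?b2 \<star> d' = cubic b \<cdot> a2"
    unfolding d'_def swap_right[of ?b2 a2 b] using mb2(4) by simp
  have ab: "polar a b = 0" "polar a ?b2 = 0" "polar a2 b = 0" "polar a2 ?b2 = 0"
    by (rule pb mb2)+
  have ac: "polar a c = 0" "polar a2 c = 0" "polar a d = 0" "polar a2 d = 0"
    "polar a d' = 0" "polar a2 d' = 0"
    by (rule plus_products[OF plus_c] minus_products[OF minus_d] plus_products[OF plus_d'])+
  have ac'0: "polar a c' = 0" "polar a2 c' = 0"
  proof -
    have "polar c' a = 0" "polar c' a2 = 0"
      unfolding c'_def polar_assoc using mb2(3) by (simp_all add: polar_linear)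
    then show "polar a c' = 0" "polar a2 c' = 0" by (simp_all add: polar_commute)
  qed
  have bc: "polar b c = 0" "polar c ?b2 = 0"
  proof -
    show "polar b c = 0" unfolding c_def polar_assoc[symmetric] b2[symmetric] by (rule mb2)
    show "polar c ?b2 = 0" unfolding c_def polar_rotate[of b a] by simp
  qed
  have bc': "polar c' b = 0" "polar c' ?b2 = 0"
    unfolding c'_def polar_rotate[of ?b2 a2] using ab by (simp_all add: polar_linear)
  have bd: "polar d b = 0" "polar d ?b2 = 0"
    unfolding d_def polar_assoc using ab by (simp_all add: polar_linear)
  have bd': "polar d' b = 0" "polar d' ?b2 = 0"
    unfolding d'_def polar_assoc using ab by (simp_all add: b2[symmetric])
  have cc': "polar c c' = cubic a * cubic b"
    unfolding c_def polar_assoc ac' by (simp add: polar_linear)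
  have cd: "polar c d = 0"
    unfolding c_def polar_assoc ad using bc' by (simp add: polar_linear polar_commute)
  have cd': "polar c d' = 0"
    unfolding c_def polar_assoc using plus_products(1)[OF plus_d'] by simp
  have c'd: "polar c' d = 0"
    unfolding c'_def polar_assoc using minus_products(4)[OF minus_d] by simp
  have c'd': "polar c' d' = 0"
    unfolding c'_def polar_rotate[of ?b2 a2] d'b2 by simp
  have dd': "polar d d' = cubic a * cubic b"
    unfolding d_def polar_assoc b2d' by (simp add: polar_linear)
  note gram = ab ac ac'0 bc bc' bd bd' cc' cd cd' c'd c'd' dd'
  note gram = gram gram[THEN trans[OF polar_commute]] n_zero[THEN polar_self_zero]
  let ?us = "[a, a2, b, ?b2, c, c', d, d']" and ?ws = "[a2, a, ?b2, b, c', c, d', d]"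
  have "span (set ?us) = UNIV"
  proof (rule span_of_dual_family[where ws = ?ws])
    have "\<forall>i<8. \<forall>j<8. polar (?us ! i) (?ws ! j) = 0 \<longleftrightarrow> i \<noteq> j"
      using cubic_a b(2) by (simp add: numeral_eq_Suc All_less_Suc gram)
    then show "\<And>i j. i < 8 \<Longrightarrow> j < 8 \<Longrightarrow> polar (?us ! i) (?ws ! j) = 0 \<longleftrightarrow> i \<noteq> j" by blast
  qed simp
  moreover have "set ?us \<subseteq> B"
    using B(2-4) by (simp add: a2_def b2 c_def d_def c'_def d'_def)
  then have "span (set ?us) \<subseteq> B" by (rule span_minimal[OF _ B(1)])
  ultimately show ?thesis by blast
qed

text \<open>The relation \<open>a \<star> b = 0\<close> removes one word of length two and leaves, by swapping, only
  \<open>b \<star> (b \<star> a)\<close> and \<open>(b \<star> a) \<star> a\<close> among the words of length three.\<close>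

lemma word_span_three_cubic_pair:
  assumes b: "plus_part b"
  shows "word_span {a, b} 3 \<subseteq> span {a, b, a2, b \<star> b, b \<star> a, b \<star> (b \<star> a), (b \<star> a) \<star> a}"
    (is "_ \<subseteq> span ?T")
proof (rule word_span_three_leI)
  note pb = plus_products[OF b]
  have mem: "t \<in> ?T \<Longrightarrow> t \<in> span ?T" for t by (rule span_base)
  have products: "a \<star> a = a2" "a \<star> b = 0" by (simp_all add: a2_def pb)
  have b2a: "(b \<star> b) \<star> a = 0" using square_of_plus[OF b] by (simp add: part_defs)
  show "word_span {a, b} 2 \<subseteq> span ?T"
    unfolding word_span_two by (rule span_minimal) (auto simp: products span_zero intro: mem)
  fix x y z assume "x \<in> {a, b}" "y \<in> {a, b}" "z \<in> {a, b}"
  then show "(x \<star> y) \<star> z \<in> span ?T \<and> x \<star> (y \<star> z) \<in> span ?T"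
    by (elim insertE emptyE; hypsubst)
       (simp_all add: products pb b2a comp_left comp_right n_a span_zero span_neg span_base)
qed simp

end

context eight_dim_symmetric_composition
begin

lemma algebra_length_isotropic:
  assumes "x \<noteq> 0" "n x = 0"
  shows "algebra_length = 4"
proof -
  obtain a b where a: "n a = 0" "cubic a \<noteq> 0" and b: "right_annihilated a b" "cubic b \<noteq> 0"
    using cubic_pair assms by blast
  interpret isotropic_element scale mult n Basis a by unfold_locales (use a in auto)
  let ?T = "{a, b, a2, b \<star> b, b \<star> a, b \<star> (b \<star> a), (b \<star> a) \<star> a}"
  show ?thesis
  proof (rule algebra_length_eq_fourI)
    show "word_span {a, b} 3 \<subseteq> span ?T" by (rule word_span_three_cubic_pair[OF b(1)])
    show "card ?T < 8" using card_length[of "[a, b, a2, b \<star> b, b \<star> a, b \<star> (b \<star> a), (b \<star> a) \<star> a]"] by simp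
    fix B assume "subspace B" "\<And>x y. x \<in> B \<Longrightarrow> y \<in> B \<Longrightarrow> x \<star> y \<in> B" "{a, b} \<subseteq> B"
    then show "B = UNIV" using generated_by_cubic_pair[OF b, of B] by blast
  qed simp
qed

end

section \<open>The anisotropic case with an idempotent\<close>

locale anisotropic_with_idempotent = eight_dim_symmetric_composition scale mult n Basis
  for scale :: "'a::field \<Rightarrow> 'v::ab_group_add \<Rightarrow> 'v" (infixr \<open>\<cdot>\<close> 75)
    and mult :: "'v \<Rightarrow> 'v \<Rightarrow> 'v" (infixl \<open>\<star>\<close> 70) and n and Basis +
  fixes e :: 'v
  assumes anisotropic: "n x = 0 \<Longrightarrow> x = 0"
    and e_nonzero: "e \<noteq> 0" and e_square: "e \<star> e = e"
begin

lemma n_e: "n e = 1"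
proof -
  have "n e \<cdot> e = 1 \<cdot> e" using comp_left[of e e] by (simp add: e_square)
  then show ?thesis using e_nonzero by (simp only: scale_cancel_right) simp
qed

lemma mult_eq_zero: "x \<star> y = 0 \<Longrightarrow> x = 0 \<or> y = 0"
  using n_mult[of x y] anisotropic by auto

text \<open>For \<open>v \<notin> B\<close>, an element \<open>x \<star> v\<close> of \<open>B\<close> with \<open>x \<in> B\<close> gives \<open>(x \<star> v) \<star> x = n x \<cdot> v \<in> B\<close>, so
  \<open>x = 0\<close>. Hence \<open>B\<close> and its image under \<open>x \<mapsto> x \<star> v\<close> are independent subspaces of equal
  dimension, which is then at most four.\<close>

lemma subalgebra_eq_UNIV:
  assumes B: "subspace B" "\<And>x y. x \<in> B \<Longrightarrow> y \<in> B \<Longrightarrow> x \<star> y \<in> B"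
    and C: "C \<subseteq> B" "independent C" "card C = 5"
  shows "B = UNIV"
proof (rule ccontr)
  assume "B \<noteq> UNIV"
  then obtain v where v: "v \<notin> B" by blast
  then have "v \<noteq> 0" using subspace_0[OF B(1)] by auto
  interpret pair: finite_dimensional_vector_space_pair scale Basis scale Basis ..
  have linear: "Vector_Spaces.linear scale scale (\<lambda>x. x \<star> v)"
    unfolding Vector_Spaces.linear_iff by (simp add: mult_linear vector_space_axioms)
  have "inj_on (\<lambda>x. x \<star> v) B"
  proof (rule inj_onI)
    fix x y assume "x \<star> v = y \<star> v"
    then have "(x - y) \<star> v = 0" by (simp add: mult_linear)
    then show "x = y" using mult_eq_zero \<open>v \<noteq> 0\<close> by force
  qed
  then have dim_image: "dim ((\<lambda>x. x \<star> v) ` B) = dim B"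
    using pair.dim_image_eq[OF linear, of B] B(1) by (simp add: span_eq_iff[THEN iffD2])
  have "B \<inter> (\<lambda>x. x \<star> v) ` B \<subseteq> {0}"
  proof safe
    fix x assume x: "x \<in> B" "x \<star> v \<in> B"
    have "n x \<cdot> v \<in> B" unfolding comp_left[symmetric] by (rule B) (rule x)+
    have "n x = 0"
    proof (rule ccontr)
      assume "n x \<noteq> 0"
      then have "v = inverse (n x) \<cdot> (n x \<cdot> v)" by simp
      then show False using v subspace_scale[OF B(1) \<open>n x \<cdot> v \<in> B\<close>] by metis
    qed
    then have "x = 0" by (rule anisotropic)
    then show "x \<star> v = 0" by simp
  qed
  then have "dim (B \<inter> (\<lambda>x. x \<star> v) ` B) = 0" by (simp only: dim_eq_0)
  moreover have "subspace ((\<lambda>x. x \<star> v) ` B)"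
    by (rule pair.linear_subspace_image[OF linear B(1)])
  ultimately have "dim {x + y |x y. x \<in> B \<and> y \<in> (\<lambda>x. x \<star> v) ` B} = 2 * dim B"
    using dim_sums_Int[OF B(1), of "(\<lambda>x. x \<star> v) ` B"] dim_image by linarith
  moreover have "5 \<le> dim B" using independent_card_le_dim[OF C(1,2)] C(3) by simp
  moreover have "dim {x + y |x y. x \<in> B \<and> y \<in> (\<lambda>x. x \<star> v) ` B} \<le> 8"
    by (rule order_trans[OF dim_subset_UNIV]) (simp add: dimension_def card_Basis)
  ultimately show False by simp
qed

text \<open>For \<open>x\<close> orthogonal to \<open>e\<close> this is \<open>- (x \<star> e)\<close>. Its cube is the identity, and its fixed
  vectors are the elements that commute with \<open>e\<close>.\<close>

definition rot :: "'v \<Rightarrow> 'v" where "rot x = e \<star> (e \<star> x)"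

lemma left_right: "e \<star> (x \<star> e) = x" "(e \<star> x) \<star> e = x"
  by (simp_all add: comp_left comp_right n_e)

lemma right_mult_e: "x \<star> e = polar x e \<cdot> e - rot x"
  using swap_right[of x e e] by (simp add: rot_def e_square)

lemma polar_e_mult: "polar (e \<star> x) e = polar x e" "polar (x \<star> e) e = polar x e"
  by (simp_all only: polar_rotate[of e x] polar_assoc[of x e] e_square)

lemma polar_rot_e: "polar (rot x) e = polar x e"
  by (simp add: rot_def polar_e_mult)

lemma n_rot: "n (rot x) = n x"
  by (simp add: rot_def n_mult n_e)

lemma rot_linear: "rot (x + y) = rot x + rot y" "rot (x - y) = rot x - rot y"
  "rot (c \<cdot> x) = c \<cdot> rot x" "rot 0 = 0" "rot (- x) = - rot x"
  by (simp_all add: rot_def mult_linear)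

lemma rot_e: "rot e = e"
  by (simp add: rot_def e_square)

lemma rot_cubed: "rot (rot (rot x)) = x"
proof -
  have cube: "e \<star> (e \<star> (e \<star> x)) = polar x e \<cdot> e - x" for x
    using arg_cong[OF right_mult_e[of x], of "\<lambda>y. e \<star> y"]
    by (simp add: left_right mult_linear e_square rot_def algebra_simps)
  show ?thesis
    unfolding rot_def cube by (simp add: cube mult_linear polar_linear e_square)
       (simp add: polar_e_mult polar_self n_e cube)
qed

lemma commutes_iff: "e \<star> x = x \<star> e \<longleftrightarrow> rot x = x"
proof
  assume "e \<star> x = x \<star> e"
  then show "rot x = x" unfolding rot_def by (simp add: left_right)
next
  assume "rot x = x"
  then have "e \<star> (e \<star> x) = e \<star> (x \<star> e)" by (simp add: rot_def left_right)
  then have "e \<star> (e \<star> x - x \<star> e) = 0" by (simp add: mult_linear)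
  then show "e \<star> x = x \<star> e" using mult_eq_zero e_nonzero by force
qed

text \<open>The kernel of \<open>1 + rot + rot\<^sup>2\<close> on the orthogonal complement of \<open>e\<close>. It contains every
  \<open>x - rot x\<close>, and outside characteristic three it is a complement of the fixed vectors.\<close>

definition moved :: "'v \<Rightarrow> bool" where
  "moved d \<longleftrightarrow> d + rot d + rot (rot d) = 0 \<and> polar d e = 0"

lemma moved_diff: "moved (x - rot x)"
  by (simp add: moved_def rot_linear rot_cubed polar_linear polar_rot_e)

lemma subspace_moved: "subspace {d. moved d}"
proof -
  have "moved (x + y)" if "moved x" "moved y" for x y
  proof -
    have eq: "(x + y) + rot (x + y) + rot (rot (x + y)) =
      (x + rot x + rot (rot x)) + (y + rot y + rot (rot y))" by (simp add: rot_linear algebra_simps)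
    show ?thesis using that unfolding moved_def eq polar_linear by simp
  qed
  moreover have "moved (c \<cdot> x)" if "moved x" for c x
  proof -
    have eq: "c \<cdot> x + rot (c \<cdot> x) + rot (rot (c \<cdot> x)) = c \<cdot> (x + rot x + rot (rot x))"
      by (simp add: rot_linear scale_right_distrib)
    show ?thesis using that unfolding moved_def eq polar_linear by simp
  qed
  moreover have "moved 0" by (simp add: moved_def rot_linear)
  ultimately show ?thesis by (simp add: subspace_def)
qed

text \<open>Most of these follow from \<open>d \<star> e = - rot d\<close> and \<open>e \<star> d = d + rot d\<close>, inserted into the
  composition identity. The one to note is that \<open>d \<star> d\<close> commutes with \<open>e\<close>.\<close>

lemma moved_products:
  assumes "moved d"
  shows "rot (rot d) = - d - rot d" "d \<star> e = - rot d" "e \<star> d = d + rot d" "e \<star> rot d = - d"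
    "polar (rot d) e = 0" "rot d \<star> e = d + rot d" "moved (rot d)"
    "rot d \<star> d = - (n d \<cdot> e)" "d \<star> rot d = n d \<cdot> e - d \<star> d"
    "e \<star> (d \<star> d) = (d \<star> d) \<star> e"
proof -
  have zero: "d + rot d + rot (rot d) = 0" and perp: "polar d e = 0"
    using assms by (simp_all add: moved_def)
  show 1: "rot (rot d) = - d - rot d" using zero by (simp add: algebra_simps eq_neg_iff_add_eq_0)
  show 2: "d \<star> e = - rot d" using right_mult_e[of d] perp by simp
  show 5: "polar (rot d) e = 0" using perp by (simp add: polar_rot_e)
  have 6: "rot d \<star> e = - rot (rot d)" using right_mult_e[of "rot d"] 5 by simp
  then show 6: "rot d \<star> e = d + rot d" by (simp add: 1)
  have "e \<star> d = - ((d \<star> e) \<star> e)"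
    using swap_left[of d e e] perp by (simp add: e_square)
  then show 3: "e \<star> d = d + rot d" by (simp add: 2 mult_linear 6)
  have "e \<star> (d \<star> e) = d" by (rule left_right)
  then show 4: "e \<star> rot d = - d" by (simp add: 2 mult_linear minus_equation_iff)
  show "moved (rot d)" using zero 5 by (simp add: moved_def 1 rot_linear)
  have "(d \<star> e) \<star> d = n d \<cdot> e" by (rule comp_left)
  then show 8: "rot d \<star> d = - (n d \<cdot> e)" by (simp add: 2 mult_linear minus_equation_iff)
  have "d \<star> (e \<star> d) = n d \<cdot> e" by (rule comp_right)
  then show 9: "d \<star> rot d = n d \<cdot> e - d \<star> d" by (simp add: 3 mult_linear algebra_simps)
  have "e \<star> (d \<star> d) = d \<star> rot d"
    using swap_right[of e d d] perp by (simp add: 2 mult_linear polar_commute)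
  moreover have "(d \<star> d) \<star> e = d \<star> rot d"
    using swap_left[of d d e] perp by (simp add: 3 mult_linear 8 9 polar_commute)
  ultimately show "e \<star> (d \<star> d) = (d \<star> d) \<star> e" by simp
qed

text \<open>In characteristic three \<open>d = x - rot x\<close> satisfies \<open>n (d - rot d) = 3 * n d = 0\<close>, so \<open>d\<close> is
  fixed. Then \<open>n\<close> takes the same value at \<open>x\<close>, \<open>x - d\<close> and \<open>x + d\<close>, which gives \<open>n d = 0\<close>. So
  \<open>rot\<close> would be the identity and \<open>e\<close> would commute with everything.\<close>

lemma char_not_three: "(3::'a) \<noteq> 0"
proof
  assume three: "(3::'a) = 0"
  have triple: "x + x + x = 0" for x :: 'v
    using scale_left_distrib[of 2 1 x] scale_left_distrib[of 1 1 x] three by simp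
  have "rot x = x" for x
  proof -
    define d where "d = x - rot x"
    have d: "moved d" unfolding d_def by (rule moved_diff)
    note md = moved_products[OF d]
    have "n d + n d + polar d (rot d) = n d"
      using n_rot[of "rot d"] n_rot[of d] n_add[of d "rot d"] n_minus[of "d + rot d"] by (simp add: md(1))
    then have "polar d (rot d) = - n d" by (simp add: eq_neg_iff_add_eq_0 algebra_simps)
    then have "n (d - rot d) = 3 * n d" by (simp add: n_diff n_rot)
    then have "n (d - rot d) = 0" using three by simp
    then have "d - rot d = 0" by (rule anisotropic)
    then have "rot d = d" by simp
    have rx: "rot x = x - d" by (simp add: d_def)
    have "rot (rot x) = x - d - d" using arg_cong[OF rx, of rot] rx \<open>rot d = d\<close> by (simp add: rot_linear)
    also have "\<dots> = x + d" using triple[of d] by (simp add: algebra_simps)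
    finally have "n (x + d) = n x" using n_rot[of "rot x"] n_rot[of x] by simp
    moreover have "n (x - d) = n x" using n_rot[of x] rx by simp
    ultimately have two: "2 * n d = 0" by (simp add: n_add n_diff)
    have "n d = 3 * n d - 2 * n d" using left_diff_distrib[of 3 2 "n d"] by simp
    also have "\<dots> = 0" unfolding two three by simp
    finally have "n d = 0" .
    then show "rot x = x" using anisotropic rx by simp
  qed
  then have "e \<star> x = x \<star> e" for x by (simp add: commutes_iff)
  then have "e = 0" by (rule commuting_eq_zero)
  then show False using e_nonzero by simp
qed

lemma triple: "x + x + x = 3 \<cdot> x" for x :: 'v
  using scale_left_distrib[of 2 1 x] scale_left_distrib[of 1 1 x] by simp

lemma moved_fixed: "moved d \<Longrightarrow> rot d = d \<Longrightarrow> d = 0"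
  using char_not_three triple[of d] by (simp add: moved_def)

text \<open>An eigenvalue \<open>k\<close> satisfies \<open>1 + k + k\<^sup>2 = 0\<close>, and \<open>k\<^sup>2 = 1\<close> because \<open>rot\<close> preserves \<open>n\<close>. Together
  these give \<open>k = - 2\<close> and \<open>3 = 0\<close>.\<close>

lemma moved_not_eigen:
  assumes d: "moved d" and eigen: "rot d = k \<cdot> d"
  shows "d = 0"
proof (rule ccontr)
  assume "d \<noteq> 0"
  then have nd: "n d \<noteq> 0" using anisotropic by blast
  have "d + k \<cdot> d + k \<cdot> k \<cdot> d = 0" using d eigen unfolding moved_def by (simp add: rot_linear)
  then have "(1 + k + k\<^sup>2) \<cdot> d = 0" by (simp add: scale_left_distrib power2_eq_square)
  then have 1: "1 + k + k\<^sup>2 = 0" using \<open>d \<noteq> 0\<close> by simp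
  have "k\<^sup>2 * n d = n d" using n_rot[of d] eigen by (simp add: n_scale)
  then have 2: "k\<^sup>2 = 1" using nd by simp
  then have "k = - 2" using 1 by (simp add: eq_neg_iff_add_eq_0 algebra_simps)
  then have "(3::'a) + 1 = 0 + 1" using 2 by simp
  then show False using char_not_three by (simp only: add_right_cancel)
qed

text \<open>From \<open>d \<star> d = k \<cdot> e\<close> it follows that \<open>n d \<cdot> d = d \<star> (d \<star> d) = - (k \<cdot> rot d)\<close>, so that \<open>d\<close> would be an
  eigenvector of \<open>rot\<close>.\<close>

lemma moved_square_not_scalar:
  assumes d: "moved d" "d \<noteq> 0"
  shows "d \<star> d \<notin> span {e}"
proof
  assume "d \<star> d \<in> span {e}"
  then obtain k where k: "d \<star> d = k \<cdot> e" by (auto simp: span_singleton)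
  have "n d \<cdot> d = - (k \<cdot> rot d)"
    using comp_right[of d d] by (simp add: k mult_linear moved_products(2)[OF d(1)])
  moreover have "n d \<noteq> 0" using anisotropic d by blast
  ultimately have "k \<noteq> 0" using d by auto
  then have "rot d = inverse k \<cdot> (k \<cdot> rot d)" by simp
  also have "\<dots> = (- (n d) / k) \<cdot> d"
    using \<open>n d \<cdot> d = - (k \<cdot> rot d)\<close> by (simp add: divide_inverse mult.commute flip: scale_scale)
  finally show False using moved_not_eigen d by blast
qed

text \<open>Suppose that the fixed vectors are spanned by \<open>e\<close> and \<open>f = d \<star> d\<close>. For every moved \<open>x\<close> the
  square \<open>x \<star> x = s \<cdot> e + t \<cdot> f\<close> commutes with \<open>x\<close> and \<open>t \<noteq> 0\<close>, so the commutator of \<open>f\<close> with \<open>x\<close> is a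
  multiple of the commutator of \<open>e\<close> with \<open>x\<close>. The factor does not depend on \<open>x\<close>, and it is zero
  for \<open>x = d\<close>. So \<open>f\<close> commutes with the moved and with the fixed vectors, that is, with
  everything, and \<open>f = 0\<close>, contrary to \<open>moved_square_not_scalar\<close>.\<close>

lemma exists_third_fixed:
  assumes d: "moved d" "d \<noteq> 0"
  shows "\<exists>c. rot c = c \<and> c \<notin> span {e, d \<star> d}"
proof (rule ccontr)
  assume "\<not> ?thesis"
  then have fixed: "\<And>c. rot c = c \<Longrightarrow> c \<in> span {e, d \<star> d}" by blast
  define f where "f = d \<star> d"
  have ef: "e \<star> f = f \<star> e" unfolding f_def by (rule moved_products(10)[OF d(1)])
  define T where "T x = e \<star> x - x \<star> e" for x
  define D where "D x = f \<star> x - x \<star> f" for x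
  have T_inj: "x = 0" if "moved x" "T x = 0" for x
    using that moved_fixed commutes_iff[of x] by (simp add: T_def)
  have "D x \<in> span {T x}" if x: "moved x" for x
  proof (cases "x = 0")
    case False
    have "x \<star> x \<in> span {e, f}" unfolding f_def
      using fixed[of "x \<star> x"] commutes_iff moved_products(10)[OF x] by blast
    then obtain s t where st: "x \<star> x = s \<cdot> e + t \<cdot> f"
      by (auto simp: span_insert span_singleton algebra_simps)
    have "t \<noteq> 0"
      using moved_square_not_scalar[OF x False] st by (auto simp: span_base span_scale)
    have "(x \<star> x) \<star> x = x \<star> (x \<star> x)" by (simp add: comp_left comp_right)
    then have "t \<cdot> D x = - (s \<cdot> T x)"
      unfolding st by (simp add: mult_linear T_def D_def scale_right_diff_distrib algebra_simps)
    then have "inverse t \<cdot> (t \<cdot> D x) = inverse t \<cdot> (- (s \<cdot> T x))" by (rule arg_cong)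
    then have "D x = (- (inverse t * s)) \<cdot> T x" using \<open>t \<noteq> 0\<close> by simp
    then show ?thesis by (simp only: span_scale span_base singletonI)
  qed (simp add: D_def span_zero)
  then obtain k where k: "\<And>x. moved x \<Longrightarrow> D x = k \<cdot> T x"
    using pointwise_proportional[OF subspace_moved, of D T] T_inj
    by (auto simp: D_def T_def mult_linear algebra_simps)
  have "D d = 0" by (simp add: D_def f_def comp_left comp_right)
  then have "k = 0" using k[OF d(1)] T_inj d by auto
  have f_moved: "f \<star> x = x \<star> f" if "moved x" for x
    using k[OF that] \<open>k = 0\<close> by (simp add: D_def)
  have f_fixed: "f \<star> x = x \<star> f" if fx: "rot x = x" for x
  proof -
    obtain s t where "x = s \<cdot> e + t \<cdot> f"
      using fixed[OF fx] by (auto simp: f_def span_insert span_singleton algebra_simps)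
    then show ?thesis by (simp add: mult_linear ef)
  qed
  have "f = 0"
  proof (rule commuting_eq_zero)
    fix y
    have "rot (y + rot y + rot (rot y)) = y + rot y + rot (rot y)"
      by (simp add: rot_linear rot_cubed algebra_simps)
    then have 1: "f \<star> (y + rot y + rot (rot y)) = (y + rot y + rot (rot y)) \<star> f" by (rule f_fixed)
    have 2: "f \<star> (y - rot y) = (y - rot y) \<star> f" by (rule f_moved[OF moved_diff])
    have "moved (- (rot (rot y) - rot (rot (rot y))))"
      using subspace_neg[OF subspace_moved] moved_diff by blast
    then have 3: "f \<star> (y - rot (rot y)) = (y - rot (rot y)) \<star> f" using f_moved by (simp add: rot_cubed)
    \<comment> \<open>Every vector is a third of a fixed vector plus two moved ones.\<close>
    have "y + y + y = (y + rot y + rot (rot y)) + (y - rot y) + (y - rot (rot y))" by simp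
    then have "3 \<cdot> y = (y + rot y + rot (rot y)) + (y - rot y) + (y - rot (rot y))"
      by (simp only: triple)
    moreover have "f \<star> (p + q + r) = (p + q + r) \<star> f"
      if "f \<star> p = p \<star> f" "f \<star> q = q \<star> f" "f \<star> r = r \<star> f" for p q r
      using that by (simp add: mult_linear)
    ultimately have "f \<star> (3 \<cdot> y) = (3 \<cdot> y) \<star> f" using 1 2 3 by metis
    then show "f \<star> y = y \<star> f" using char_not_three by (simp add: mult_linear)
  qed
  then show False using moved_square_not_scalar[OF d] by (simp add: f_def span_zero)
qed

text \<open>With \<open>d\<close> moved, \<open>f = d \<star> d\<close> and a third fixed vector \<open>c\<close>, take the letters \<open>e\<close> and \<open>b = c + d\<close>.
  The commutator of \<open>e\<close> with \<open>b\<close> only sees \<open>d\<close>; so \<open>d\<close>, \<open>rot d\<close> and then \<open>c\<close> lie in the generated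
  subalgebra. It contains the independent elements \<open>e\<close>, \<open>f\<close>, \<open>c\<close>, \<open>d\<close>, \<open>rot d\<close>.\<close>

lemma algebra_length_anisotropic: "algebra_length = 4"
proof -
  have "\<exists>x. rot x \<noteq> x"
  proof (rule ccontr)
    assume "\<not> ?thesis"
    then have "e \<star> x = x \<star> e" for x by (simp add: commutes_iff)
    then show False using commuting_eq_zero e_nonzero by blast
  qed
  then obtain x where x: "rot x \<noteq> x" ..
  define d where "d = x - rot x"
  have d: "moved d" "d \<noteq> 0" using moved_diff x by (simp_all add: d_def)
  note md = moved_products[OF d(1)]
  define f where "f = d \<star> d"
  obtain c where c: "rot c = c" "c \<notin> span {e, f}" using exists_third_fixed[OF d] f_def by blast
  have ec: "e \<star> c = c \<star> e" using c by (simp add: commutes_iff)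
  define b where "b = c + d"
  let ?T = "{e, b, e \<star> b, b \<star> e, b \<star> b, e \<star> (b \<star> b), (b \<star> b) \<star> e}"
  show ?thesis
  proof (rule algebra_length_eq_fourI)
    fix B assume sub: "subspace B" and closed: "\<And>x y. x \<in> B \<Longrightarrow> y \<in> B \<Longrightarrow> x \<star> y \<in> B"
      and "{e, b} \<subseteq> B"
    then have eb: "e \<in> B" "b \<in> B" by auto
    define t where "t = e \<star> b - b \<star> e"
    have t: "t = d + rot d + rot d" by (simp add: t_def b_def mult_linear ec md)
    have "t \<in> B" unfolding t_def by (intro subspace_diff sub closed eb)
    moreover have "e \<star> t = rot d - d" by (simp add: t mult_linear md)
    ultimately have tB: "t \<in> B" "rot d - d \<in> B" using closed[OF eb(1), of t] by auto
    have "t + (rot d - d) = 3 \<cdot> rot d" using triple[of "rot d"] by (simp add: t)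
    then have "3 \<cdot> rot d \<in> B" using subspace_add[OF sub tB] by simp
    then have "inverse 3 \<cdot> 3 \<cdot> rot d \<in> B" by (rule subspace_scale[OF sub])
    then have "rot d \<in> B" using char_not_three by simp
    moreover have "d \<in> B" using subspace_diff[OF sub \<open>rot d \<in> B\<close> tB(2)] by simp
    moreover have "c \<in> B" using subspace_diff[OF sub eb(2) \<open>d \<in> B\<close>] by (simp add: b_def)
    moreover have "f \<in> B" unfolding f_def by (intro closed \<open>d \<in> B\<close>)
    ultimately have inB: "{rot d, d, c, f, e} \<subseteq> B" using eb by simp
    have sub_fixed: "subspace {x. rot x = x}" by (simp add: subspace_def rot_linear)
    have "rot f = f" using md(10) by (simp add: commutes_iff f_def)
    then have fixed: "span {c, f, e} \<subseteq> {x. rot x = x}"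
      using c by (intro span_minimal sub_fixed) (auto simp: rot_e)
    have f_new: "f \<notin> span {e}" unfolding f_def by (rule moved_square_not_scalar[OF d])
    have c_new: "c \<notin> span {f, e}" using c by (simp add: insert_commute)
    have d_new: "d \<notin> span {c, f, e}" using fixed moved_fixed d by blast
    have rot_d_new: "rot d \<notin> span {d, c, f, e}"
    proof
      assume "rot d \<in> span {d, c, f, e}"
      then obtain k where "rot d - k \<cdot> d \<in> span {c, f, e}" by (auto simp: span_breakdown_eq)
      then have "rot (rot d - k \<cdot> d) = rot d - k \<cdot> d" using fixed by blast
      moreover have "moved (rot d - k \<cdot> d)"
        using subspace_diff[OF subspace_moved] subspace_scale[OF subspace_moved] md(7) d(1) by blast
      ultimately have "rot d - k \<cdot> d = 0" using moved_fixed by blast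
      then show False using moved_not_eigen[OF d(1), of k] d(2) by simp
    qed
    note new = f_new c_new d_new rot_d_new
    have notin: "z \<notin> M" if "z \<notin> span M" for z M using that span_base by blast
    have "independent {rot d, d, c, f, e}"
      by (intro independent_insertI new independent_empty) (simp add: e_nonzero)
    moreover have "card {rot d, d, c, f, e} = 5" using new[THEN notin] by simp
    ultimately show "B = UNIV" using subalgebra_eq_UNIV[OF sub closed inB] by blast
  next
    have mem: "t \<in> ?T \<Longrightarrow> t \<in> span ?T" for t by (rule span_base)
    show "word_span {e, b} 3 \<subseteq> span ?T"
    proof (rule word_span_three_leI)
      show "word_span {e, b} 2 \<subseteq> span ?T"
        unfolding word_span_two by (rule span_minimal) (auto simp: e_square intro: mem)
      have eeb: "e \<star> (e \<star> b) \<in> span ?T" "b \<star> (b \<star> e) \<in> span ?T" "(e \<star> b) \<star> b \<in> span ?T"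
        "(b \<star> e) \<star> e \<in> span ?T"
        unfolding swap_right[of e e b] swap_right[of b b e] swap_left[of e b b] swap_left[of b e e]
          e_square
        by (simp_all add: span_diff span_scale span_base)
      fix x y z assume "x \<in> {e, b}" "y \<in> {e, b}" "z \<in> {e, b}"
      then show "(x \<star> y) \<star> z \<in> span ?T \<and> x \<star> (y \<star> z) \<in> span ?T"
        by (elim insertE emptyE; hypsubst)
           (simp_all add: e_square eeb comp_left comp_right span_scale span_base)
    qed simp
    show "card ?T < 8" using card_length[of "[e, b, e \<star> b, b \<star> e, b \<star> b, e \<star> (b \<star> b), (b \<star> b) \<star> e]"] by simp
  qed simp
qed

end

section \<open>The split algebra in coordinates\<close>

lemma index_set: "{(i, j). i \<in> {-1, 0, 1} \<and> j \<in> {-1, 0, 1} \<and> (i, j) \<noteq>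
  (0, 0)} =
    {(-1, -1), (-1, 0), (-1, 1), (0, -1), (0, 1), (1, -1), (1, 0), (1, 1) :: int \<times> int}"
  by auto

lemma UNIV_okubo_index: "(UNIV :: okubo_index set) = {mk_index (-1, -1), mk_index (-1, 0),
  mk_index (-1, 1), mk_index (0, -1), mk_index (0, 1), mk_index (1, -1), mk_index (1, 0),
  mk_index (1, 1)}"
  using type_definition.Abs_image[OF type_definition_okubo_index] unfolding index_set by auto

lemma mk_index_eq_iff:
  assumes "p \<in> {(-1, -1), (-1, 0), (-1, 1), (0, -1), (0, 1), (1, -1), (1, 0), (1, 1)}" "q
    \<in> {(-1, -1), (-1, 0), (-1, 1), (0, -1), (0, 1), (1, -1), (1, 0), (1, 1)}"
  shows "mk_index p = mk_index q \<longleftrightarrow> p = q"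
  using assms by (intro mk_index_inject) (simp_all only: index_set)

lemma index_pair_mk_index:
  assumes "p \<in> {(-1, -1), (-1, 0), (-1, 1), (0, -1), (0, 1), (1, -1), (1, 0), (1, 1)}"
  shows "index_pair (mk_index p) = p"
  using assms by (intro mk_index_inverse) (simp only: index_set)

lemma sum_okubo_index: "sum f (UNIV :: okubo_index set) =
    f (mk_index (-1, -1)) + f (mk_index (-1, 0)) + f (mk_index (-1, 1)) + f (mk_index (0, -1)) +
      f (mk_index (0, 1)) + f (mk_index (1, -1)) + f (mk_index (1, 0)) + f (mk_index (1, 1))"
  unfolding UNIV_okubo_index by (simp add: mk_index_eq_iff add.assoc)

lemma CARD_okubo_index: "CARD(okubo_index) = 8"
  unfolding UNIV_okubo_index by (simp add: mk_index_eq_iff)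

lemma all_okubo_index: "(\<forall>i :: okubo_index. P i) \<longleftrightarrow>
    P (mk_index (-1, -1)) \<and> P (mk_index (-1, 0)) \<and> P (mk_index (-1, 1)) \<and> P
      (mk_index (0, -1)) \<and> P (mk_index (0, 1)) \<and> P (mk_index (1, -1)) \<and> P
      (mk_index (1, 0)) \<and> P (mk_index (1, 1))"
proof -
  have "(\<forall>i :: okubo_index. P i) \<longleftrightarrow> (\<forall>i\<in>UNIV. P i)" by simp
  then show ?thesis unfolding UNIV_okubo_index by simp
qed

lemma split_mult_component:
  "split_okubo_mult x y $ mk_index (-1, -1) =
     x $ mk_index (-1, 1) * y $ mk_index (0, 1) + x $ mk_index (0, -1) * y $ mk_index (-1, 0) +
       x $ mk_index (1, 0) * y $ mk_index (1, -1) - x $ mk_index (1, 1) * y $ mk_index (1, 1)"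
  "split_okubo_mult x y $ mk_index (-1, 0) =
     x $ mk_index (-1, -1) * y $ mk_index (0, 1) + x $ mk_index (0, -1) * y $ mk_index (-1, 1) +
       x $ mk_index (1, -1) * y $ mk_index (1, 1) - x $ mk_index (1, 0) * y $ mk_index (1, 0)"
  "split_okubo_mult x y $ mk_index (-1, 1) =
     x $ mk_index (-1, 0) * y $ mk_index (0, 1) + x $ mk_index (0, -1) * y $ mk_index (-1, -1) -
       x $ mk_index (1, -1) * y $ mk_index (1, -1) + x $ mk_index (1, 1) * y $ mk_index (1, 0)"
  "split_okubo_mult x y $ mk_index (0, -1) =
     - x $ mk_index (0, 1) * y $ mk_index (0, 1) + x $ mk_index (1, -1) * y $ mk_index (-1, 0) +
       x $ mk_index (1, 0) * y $ mk_index (-1, -1) + x $ mk_index (1, 1) * y $ mk_index (-1, 1)"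
  "split_okubo_mult x y $ mk_index (0, 1) =
     x $ mk_index (-1, -1) * y $ mk_index (1, -1) + x $ mk_index (-1, 0) * y $ mk_index (1, 1) +
       x $ mk_index (-1, 1) * y $ mk_index (1, 0) - x $ mk_index (0, -1) * y $ mk_index (0, -1)"
  "split_okubo_mult x y $ mk_index (1, -1) =
     x $ mk_index (-1, -1) * y $ mk_index (-1, 0) - x $ mk_index (-1, 1) * y $ mk_index (-1, 1)
       + x $ mk_index (0, 1) * y $ mk_index (1, 1) + x $ mk_index (1, 0) * y $ mk_index (0, -1)"
  "split_okubo_mult x y $ mk_index (1, 0) =
     - x $ mk_index (-1, 0) * y $ mk_index (-1, 0) + x $ mk_index (-1, 1) * y $ mk_index (-1,
       -1) + x $ mk_index (0, 1) * y $ mk_index (1, -1) + x $ mk_index (1, 1) * y $ mk_index (0,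
       -1)"
  "split_okubo_mult x y $ mk_index (1, 1) =
     - x $ mk_index (-1, -1) * y $ mk_index (-1, -1) + x $ mk_index (-1, 0) * y $ mk_index (-1,
       1) + x $ mk_index (0, 1) * y $ mk_index (1, 0) + x $ mk_index (1, -1) * y $ mk_index (0,
       -1)"
  unfolding split_okubo_mult_def vec_lambda_beta sum_okubo_index
  by (simp_all add: index_pair_mk_index okubo_coeff_def okubo_triples_def index_bar_def)

lemma split_mult_add_left:
  "split_okubo_mult (x + y) z = split_okubo_mult x z + split_okubo_mult y z"
  by (simp add: vec_eq_iff split_okubo_mult_def sum.distrib algebra_simps)

lemma split_mult_add_right:
  "split_okubo_mult z (x + y) = split_okubo_mult z x + split_okubo_mult z y"
  by (simp add: vec_eq_iff split_okubo_mult_def sum.distrib algebra_simps)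

lemma split_mult_scale_left: "split_okubo_mult (c *s x) z = c *s split_okubo_mult x z"
  by (simp add: vec_eq_iff split_okubo_mult_def sum_distrib_left algebra_simps)

lemma split_mult_scale_right: "split_okubo_mult z (c *s x) = c *s split_okubo_mult z x"
  by (simp add: vec_eq_iff split_okubo_mult_def sum_distrib_left algebra_simps)

text \<open>The basis vectors \<open>x\<^sub>u\<close> and \<open>x\<^sub>-\<^sub>u\<close> form
  four hyperbolic pairs.\<close>

definition split_norm :: "'k::field ^ okubo_index \<Rightarrow> 'k" where
  "split_norm x =
     x $ mk_index (1, 0) * x $ mk_index (-1, 0) + x $ mk_index (0, 1) * x $ mk_index (0, -1) +
     x $ mk_index (1, 1) * x $ mk_index (-1, -1) + x $ mk_index (1, -1) * x $ mk_index (-1, 1)"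

lemma split_comp_left: "split_okubo_mult (split_okubo_mult x y) x = split_norm x *s y"
  unfolding vec_eq_iff all_okubo_index split_mult_component vector_smult_component split_norm_def
  by (intro conjI; simp add: algebra_simps)

lemma split_comp_right: "split_okubo_mult x (split_okubo_mult y x) = split_norm x *s y"
  unfolding vec_eq_iff all_okubo_index split_mult_component vector_smult_component split_norm_def
  by (intro conjI; simp add: algebra_simps)

text \<open>For each \<open>u\<close> there is a basis vector \<open>x\<^sub>v\<close> with
  \<open>x\<^sub>u \<star> x\<^sub>v\<close> a basis vector \<open>x\<^sub>w\<close> and
  \<open>x\<^sub>v \<star> x\<^sub>u = 0\<close>. As the
  multiplication respects degrees modulo three, the \<open>x\<^sub>w\<close>-coordinates of
    \<open>z \<star> x\<^sub>v\<close> and \<open>x\<^sub>v \<star> z\<close> are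
  \<open>z\<^sub>u\<close> and \<open>0\<close>.\<close>

lemma split_commuting_eq_zero:
  fixes z :: "'k::field ^ okubo_index"
  assumes "\<And>x. split_okubo_mult z x = split_okubo_mult x z"
  shows "z = 0"
proof -
  have commute: "split_okubo_mult z (axis v 1) $ w = split_okubo_mult (axis v 1) z $ w" for w v
    by (simp add: assms)
  have "z $ mk_index (-1, -1) = 0"
    using commute[of "mk_index (-1, 0)" "mk_index (1, -1)"] by (simp add: split_mult_component
      axis_def mk_index_eq_iff)
  moreover have "z $ mk_index (-1, 0) = 0"
    using commute[of "mk_index (-1, 1)" "mk_index (1, 1)"] by (simp add: split_mult_component
      axis_def mk_index_eq_iff)
  moreover have "z $ mk_index (-1, 1) = 0"
    using commute[of "mk_index (-1, -1)" "mk_index (1, 0)"] by (simp add: split_mult_component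
      axis_def mk_index_eq_iff)
  moreover have "z $ mk_index (0, -1) = 0"
    using commute[of "mk_index (-1, -1)" "mk_index (-1, 1)"] by (simp add: split_mult_component
      axis_def mk_index_eq_iff)
  moreover have "z $ mk_index (0, 1) = 0"
    using commute[of "mk_index (1, -1)" "mk_index (1, 0)"] by (simp add: split_mult_component
      axis_def mk_index_eq_iff)
  moreover have "z $ mk_index (1, -1) = 0"
    using commute[of "mk_index (-1, 0)" "mk_index (0, -1)"] by (simp add: split_mult_component
      axis_def mk_index_eq_iff)
  moreover have "z $ mk_index (1, 0) = 0"
    using commute[of "mk_index (-1, -1)" "mk_index (0, -1)"] by (simp add: split_mult_component
      axis_def mk_index_eq_iff)
  moreover have "z $ mk_index (1, 1) = 0"
    using commute[of "mk_index (-1, 1)" "mk_index (0, -1)"] by (simp add: split_mult_component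
      axis_def mk_index_eq_iff)
  ultimately show ?thesis unfolding vec_eq_iff all_okubo_index by simp
qed

lemma split_norm_nondegenerate:
  fixes z :: "'k::field ^ okubo_index"
  assumes "\<And>x. split_norm (z + x) = split_norm z + split_norm x"
  shows "z = 0"
proof -
  have "z $ v = 0" for v
  proof -
    have "\<forall>v. z $ v = 0"
      unfolding all_okubo_index
      using assms[of "axis (mk_index (-1, -1)) 1"]
        assms[of "axis (mk_index (-1, 0)) 1"]
        assms[of "axis (mk_index (-1, 1)) 1"]
        assms[of "axis (mk_index (0, -1)) 1"]
        assms[of "axis (mk_index (0, 1)) 1"]
        assms[of "axis (mk_index (1, -1)) 1"]
        assms[of "axis (mk_index (1, 0)) 1"]
        assms[of "axis (mk_index (1, 1)) 1"]
      by (simp add: split_norm_def axis_def mk_index_eq_iff algebra_simps)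
    then show ?thesis by blast
  qed
  then show ?thesis by (simp add: vec_eq_iff)
qed

section \<open>Descent from the algebraic closure\<close>

text \<open>The additive extension of \<open>h\<close> to the free abelian group, with values in a ring, whereas
  \<open>frag_extend\<close> takes values in another free abelian group.\<close>

definition free_eval :: "('b \<Rightarrow> 'k::comm_ring_1) \<Rightarrow> ('b \<Rightarrow>\<^sub>0 int) \<Rightarrow> 'k" where
  "free_eval h x = (\<Sum>p\<in>Poly_Mapping.keys x. of_int (Poly_Mapping.lookup x p) * h p)"

lemma free_eval_superset:
  assumes "finite M" "Poly_Mapping.keys x \<subseteq> M"
  shows "free_eval h x = (\<Sum>p\<in>M. of_int (Poly_Mapping.lookup x p) * h p)"
  unfolding free_eval_def
  by (rule sum.mono_neutral_left) (use assms in \<open>auto simp: in_keys_iff\<close>)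

lemma free_eval_diff: "free_eval h (x - y) = free_eval h x - free_eval h y"
proof -
  let ?M = "Poly_Mapping.keys x \<union> Poly_Mapping.keys y"
  have "Poly_Mapping.keys (x - y) \<subseteq> ?M" by (rule keys_diff)
  then show ?thesis
    by (simp add: free_eval_superset[of ?M] lookup_minus sum_subtractf left_diff_distrib)
qed

lemma free_eval_zero: "free_eval h 0 = 0"
  by (simp add: free_eval_def)

lemma free_eval_of: "free_eval h (frag_of p) = h p"
  by (simp add: free_eval_def)

lemma free_eval_add: "free_eval h (x + y) = free_eval h x + free_eval h y"
  using free_eval_diff[of h "x + y" y] by (simp add: algebra_simps)

lemma free_eval_sum: "free_eval h (sum f M) = (\<Sum>i\<in>M. free_eval h (f i))"
  by (induction M rule: infinite_finite_induct) (simp_all add: free_eval_zero free_eval_add)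

context nonassoc_algebra
begin

text \<open>So a linear functional \<open>f\<close> induces \<open>v \<otimes> c \<mapsto> f v * c\<close> on the tensor product. These functionals
  are what shows that the tensor product does not collapse.\<close>

lemma functional_tensor_null:
  assumes add: "\<And>v w. f (v + w) = f v + f w" and homogeneous: "\<And>c v. f (scale c v) = c * f v"
    and "x \<in> tensor_null"
  shows "free_eval (\<lambda>(v, c). to_ac (f v) * c) x = 0"
  using assms(3)
  by (induction rule: tensor_null.induct)
     (simp_all add: free_eval_diff free_eval_of add homogeneous distrib_left distrib_right)

end

text \<open>An isomorphism of the extended algebra with the split algebra, given explicitly.\<close>

locale split_extension = nonassoc_algebra scale mult
  for scale :: "'a::field \<Rightarrow> 'v::ab_group_add \<Rightarrow> 'v" (infixr \<open>\<cdot>\<close> 75)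
    and mult :: "'v \<Rightarrow> 'v \<Rightarrow> 'v" (infixl \<open>\<star>\<close> 70) +
  fixes \<phi> :: "('v \<times> 'a alg_closure \<Rightarrow>\<^sub>0 int) set \<Rightarrow> 'a alg_closure ^ okubo_index"
  assumes bij: "bij_betw \<phi> tensor_space UNIV"
    and hom_add: "A \<in> tensor_space \<Longrightarrow> B \<in> tensor_space \<Longrightarrow> \<phi> (tensor_add A B) = \<phi> A + \<phi> B"
    and hom_scale: "A \<in> tensor_space \<Longrightarrow> \<phi> (tensor_scale k A) = k *s \<phi> A"
    and hom_mult: "A \<in> tensor_space \<Longrightarrow> B \<in> tensor_space \<Longrightarrow>
      \<phi> (tensor_mult A B) = split_okubo_mult (\<phi> A) (\<phi> B)"
begin

definition free_image :: "('v \<times> 'a alg_closure \<Rightarrow>\<^sub>0 int) \<Rightarrow> 'a alg_closure ^ okubo_index" where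
  "free_image x = \<phi> (tensor_rel `` {x})"

definition embed :: "'v \<Rightarrow> 'a alg_closure ^ okubo_index" where
  "embed v = free_image (frag_of (v, 1))"

lemma class_in_space: "tensor_rel `` {x} \<in> tensor_space"
  unfolding tensor_space_def by (rule quotientI) simp

lemma free_image_add: "free_image (x + y) = free_image x + free_image y"
  unfolding free_image_def tensor_add_class[symmetric] by (intro hom_add class_in_space)

lemma free_image_scale: "free_image (free_scale k x) = k *s free_image x"
  unfolding free_image_def tensor_scale_class[symmetric] by (intro hom_scale class_in_space)

lemma free_image_mult: "free_image (free_mult x y) = split_okubo_mult (free_image x) (free_image y)"
  unfolding free_image_def tensor_mult_class[symmetric] by (intro hom_mult class_in_space)

lemma free_image_zero: "free_image 0 = 0"
  using free_image_add[of 0 0] by simp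

lemma free_image_diff: "free_image (x - y) = free_image x - free_image y"
  using free_image_add[of "x - y" y] by (simp add: algebra_simps)

lemma free_image_eq_iff: "free_image x = free_image y \<longleftrightarrow> x - y \<in> tensor_null"
proof -
  have "free_image x = free_image y \<longleftrightarrow> tensor_rel `` {x} = tensor_rel `` {y}"
    unfolding free_image_def using bij class_in_space by (auto simp: bij_betw_def inj_on_def)
  also have "\<dots> \<longleftrightarrow> (x, y) \<in> tensor_rel"
    using eq_equiv_class_iff[OF equiv_tensor_rel] by simp
  finally show ?thesis by (simp add: tensor_rel_def)
qed

lemma free_image_eq_zero_iff: "free_image x = 0 \<longleftrightarrow> x \<in> tensor_null"
  using free_image_eq_iff[of x 0] by (simp add: free_image_zero)

lemma free_image_surj: "\<exists>x. free_image x = s"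
proof -
  obtain A where "A \<in> tensor_space" "\<phi> A = s" using bij by (metis UNIV_I bij_betw_iff_bijections)
  then show ?thesis unfolding tensor_space_def free_image_def by (auto elim: quotientE)
qed

lemma free_image_of: "free_image (frag_of (v, c)) = c *s embed v"
  using free_image_scale[of c "frag_of (v, 1)"] by (simp add: embed_def free_scale_def)

lemma embed_add: "embed (v + w) = embed v + embed w"
proof -
  have "free_image (frag_of (v + w, 1) - frag_of (v, 1) - frag_of (w, 1)) = 0"
    unfolding free_image_eq_zero_iff by (rule tensor_null.add_left)
  then show ?thesis by (simp add: free_image_diff embed_def diff_eq_eq add.commute)
qed

lemma embed_scale: "embed (c \<cdot> v) = to_ac c *s embed v"
proof -
  have "free_image (frag_of (c \<cdot> v, 1) - frag_of (v, to_ac c * 1)) = 0"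
    unfolding free_image_eq_zero_iff by (rule tensor_null.balanced)
  then show ?thesis unfolding free_image_diff by (simp add: free_image_of)
qed

lemma embed_mult: "embed (v \<star> w) = split_okubo_mult (embed v) (embed w)"
  using free_image_mult[of "frag_of (v, 1)" "frag_of (w, 1)"] by (simp add: embed_def free_mult_of)

lemma embed_zero: "embed 0 = 0"
  using embed_add[of 0 0] by simp

lemma span_range_embed: "vec.span (range embed) = UNIV"
proof -
  have "free_image x \<in> vec.span (range embed)" for x
  proof (induction x rule: frag_induct)
    case (one p)
    obtain v c where "p = (v, c)" by (cases p)
    then show ?case by (simp add: free_image_of vec.span_scale vec.span_base)
  qed (auto simp: free_image_zero free_image_diff intro: vec.span_zero vec.span_diff)
  then show ?thesis using free_image_surj by (metis UNIV_eq_I)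
qed

text \<open>Apply the extensions of the coordinate functionals of a basis that contains \<open>B\<close>.\<close>

lemma embed_independent:
  assumes "finite B" "independent B" "(\<Sum>b\<in>B. k b *s embed b) = 0" "b0 \<in> B"
  shows "k b0 = 0"
proof -
  define E where "E = extend_basis B"
  have E: "independent E" "B \<subseteq> E" "span E = UNIV"
    using assms(2) by (auto simp: E_def independent_extend_basis extend_basis_superset span_extend_basis)
  define f where "f v = representation E v b0" for v
  have f_add: "f (v + w) = f v + f w" for v w
    using representation_add[OF E(1), of w v] unfolding E(3) by (simp add: f_def)
  have f_scale: "f (c \<cdot> v) = c * f v" for c v
    using representation_scale[OF E(1), of v c] unfolding E(3) by (simp add: f_def)
  have f_basis: "f b = (if b = b0 then 1 else 0)" if "b \<in> B" for b
    using representation_basis[of E b] E that by (auto simp: f_def)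
  have image_sum: "free_image (sum g M) = (\<Sum>b\<in>M. free_image (g b))" for g and M :: "'v set"
    by (induction M rule: infinite_finite_induct) (simp_all add: free_image_zero free_image_add)
  have "free_image (\<Sum>b\<in>B. frag_of (b, k b)) = 0"
    using assms(3) by (simp add: image_sum free_image_of)
  then have "free_eval (\<lambda>(v, c). to_ac (f v) * c) (\<Sum>b\<in>B. frag_of (b, k b)) = 0"
    unfolding free_image_eq_zero_iff using functional_tensor_null f_add f_scale by blast
  then have "(\<Sum>b\<in>B. to_ac (f b) * k b) = 0" by (simp add: free_eval_sum free_eval_of)
  also have "(\<Sum>b\<in>B. to_ac (f b) * k b) = (\<Sum>b\<in>B. if b = b0 then k b else 0)"
    by (rule sum.cong) (simp_all add: f_basis)
  finally show ?thesis using assms(1,4) by simp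
qed

lemma embed_eq_zero: "embed v = 0 \<Longrightarrow> v = 0"
  using embed_independent[of "{v}" "\<lambda>_. 1" v] by (cases "v = 0") (auto simp: dependent_single)

lemma embed_inj: "embed v = embed w \<Longrightarrow> v = w"
proof -
  assume "embed v = embed w"
  then have "embed (v + (- 1) \<cdot> w) = 0" unfolding embed_add embed_scale by simp
  then have "v + (- 1) \<cdot> w = 0" by (rule embed_eq_zero)
  then show "v = w" by simp
qed

lemma embed_image_independent:
  assumes "finite B" "independent B"
  shows "vec.independent (embed ` B) \<and> card (embed ` B) = card B"
proof -
  have inj: "inj_on embed B" using embed_inj by (auto intro: inj_onI)
  have "vec.independent (embed ` B)"
    unfolding vec.independent_explicit_module
  proof (intro allI impI)
    fix M u s assume M: "finite M" "M \<subseteq> embed ` B" "(\<Sum>v\<in>M. u v *s v) = 0" "s \<in> M"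
    define C where "C = {b \<in> B. embed b \<in> M}"
    have C: "C \<subseteq> B" "embed ` C = M" using M by (auto simp: C_def)
    have "(\<Sum>b\<in>C. u (embed b) *s embed b) = 0"
      using M(3) unfolding C(2)[symmetric] sum.reindex[OF inj_on_subset[OF inj C(1)]] by simp
    moreover obtain b where "b \<in> C" "s = embed b" using M(4) C by blast
    ultimately show "u s = 0"
      using embed_independent[of C "\<lambda>b. u (embed b)" b] C assms independent_mono finite_subset
      by blast
  qed
  then show ?thesis using inj by (simp add: card_image)
qed

lemma basis_card:
  assumes "independent B" "span B = UNIV"
  shows "finite B \<and> card B = 8"
proof -
  have le: "card C \<le> 8" if "finite C" "C \<subseteq> B" for C
  proof -
    have "independent C" using assms(1) that independent_mono by blast
    then have *: "vec.independent (embed ` C)" "card (embed ` C) = card C"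
      using embed_image_independent that by blast+
    have "card (embed ` C) \<le> vec.dim (UNIV :: ('a alg_closure ^ okubo_index) set)"
      using * by (intro vec.independent_card_le_dim) auto
    then show ?thesis using * by (simp only: vec_dim_card CARD_okubo_index)
  qed
  have fin: "finite B"
  proof (rule ccontr)
    assume "infinite B"
    then obtain C where "C \<subseteq> B" "finite C" "card C = 9" using infinite_arbitrarily_large by blast
    then show False using le[of C] by simp
  qed
  have "range embed \<subseteq> vec.span (embed ` B)"
  proof safe
    fix v
    have "v \<in> span B" using assms(2) by simp
    then show "embed v \<in> vec.span (embed ` B)"
      by (induction rule: span_induct_alt)
         (auto simp: embed_zero embed_add embed_scale
           intro: vec.span_zero vec.span_add vec.span_scale vec.span_base)
  qed
  then have "vec.span (embed ` B) = UNIV"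
    using span_range_embed by (metis UNIV_I subsetI subset_antisym vec.span_minimal vec.subspace_span)
  then have "card (embed ` B) = vec.dim (UNIV :: ('a alg_closure ^ okubo_index) set)"
    using embed_image_independent[OF fin assms(1)]
    by (metis vec.dim_span vec.dim_eq_card_independent)
  then show ?thesis
    using fin embed_image_independent[OF fin assms(1)] by (simp only: vec_dim_card CARD_okubo_index)
qed

definition norm_form :: "'v \<Rightarrow> 'a" where
  "norm_form v = of_ac (split_norm (embed v))"

lemma exists_independent_pair: "\<exists>y. y \<notin> span {x :: 'v}"
proof (rule ccontr)
  assume "\<not> ?thesis"
  then have "span {x} = UNIV" by blast
  obtain B where "independent B" "span B = UNIV"
    using basis_exists[of UNIV] by (metis top.extremum_uniqueI)
  then have "card B = 8" "finite B" using basis_card by blast+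
  moreover have "card B \<le> card {x}"
    using independent_span_bound[of "{x}" B] \<open>span {x} = UNIV\<close> \<open>independent B\<close> by simp
  ultimately show False by simp
qed

text \<open>The vectors \<open>(v \<star> w) \<star> v\<close> and \<open>w\<close> become proportional over the closure, so they are
  proportional over the base field, and the factor \<open>split_norm (embed v)\<close> lies there.\<close>

lemma to_ac_norm_form: "to_ac (norm_form v) = split_norm (embed v)"
proof -
  obtain w where "w \<notin> span {0 :: 'v}" using exists_independent_pair by blast
  then have w: "w \<noteq> 0" by (auto simp: span_zero)
  define u where "u = (v \<star> w) \<star> v"
  have u: "embed u = split_norm (embed v) *s embed w"
    by (simp add: u_def embed_mult split_comp_left)
  have "u \<in> span {w}"
  proof (rule ccontr)
    assume u_notin: "u \<notin> span {w}"
    then have "u \<noteq> w" by (auto simp: span_base)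
    have "independent {u, w}" using u_notin w by (simp add: independent_insert)
    then have "(1 :: 'a alg_closure) = 0"
      using embed_independent[of "{u, w}" "\<lambda>x. if x = u then 1 else - split_norm (embed v)" u]
        \<open>u \<noteq> w\<close> u by auto
    then show False by simp
  qed
  then obtain t where "u = t \<cdot> w" by (auto simp: span_singleton)
  then have "(to_ac t - split_norm (embed v)) *s embed w = 0"
    using u by (simp add: embed_scale vec.scale_left_diff_distrib)
  then have "to_ac t = split_norm (embed v)" using embed_eq_zero w by auto
  then show ?thesis unfolding norm_form_def by (metis of_ac_to_ac)
qed

sublocale symmetric_composition scale mult norm_form
proof unfold_locales
  fix x y
  show "(x \<star> y) \<star> x = norm_form x \<cdot> y"
    by (rule embed_inj) (simp add: embed_mult embed_scale split_comp_left to_ac_norm_form)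
  show "x \<star> (y \<star> x) = norm_form x \<cdot> y"
    by (rule embed_inj) (simp add: embed_mult embed_scale split_comp_right to_ac_norm_form)
qed (rule exists_independent_pair)

text \<open>Nondegeneracy and the triviality of the commuting elements are linear conditions on the second
  argument, so they pass from the image of the algebra to its span, which is the split algebra.\<close>

lemma eight_dim: "\<exists>Basis. eight_dim_symmetric_composition scale mult norm_form Basis"
proof -
  obtain B where B: "independent B" "span B = UNIV"
    using basis_exists[of UNIV] by (metis top.extremum_uniqueI)
  have "eight_dim_symmetric_composition scale mult norm_form B"
  proof unfold_locales
    show "finite B" "card B = 8" using basis_card B by blast+
    show "independent B" "span B = UNIV" by (rule B)+
  next
    fix x assume nondeg: "\<And>y. polar x y = 0"
    have "split_norm (embed x + s) = split_norm (embed x) + split_norm s" for s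
    proof -
      define L where "L s = split_norm (embed x + s) - split_norm (embed x) - split_norm s" for s
      have "L (s + s') = L s + L s'" "L (c *s s) = c * L s" for s s' c
        by (simp_all add: L_def split_norm_def algebra_simps)
      then have "vec.subspace {s. L s = 0}"
        by (simp add: vec.subspace_def) (simp add: L_def split_norm_def)
      moreover have "L (embed y) = 0" for y
        using nondeg[of y] unfolding polar_def L_def embed_add[symmetric] to_ac_norm_form[symmetric]
        by (simp flip: to_ac_diff)
      ultimately have "vec.span (range embed) \<subseteq> {s. L s = 0}"
        by (intro vec.span_minimal) auto
      then have "L s = 0" unfolding span_range_embed by blast
      then show ?thesis by (simp add: L_def diff_eq_eq add.commute)
    qed
    then show "x = 0" by (intro embed_eq_zero split_norm_nondegenerate)
  next
    fix x assume commute: "\<And>y. x \<star> y = y \<star> x"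
    have "split_okubo_mult (embed x) s = split_okubo_mult s (embed x)" for s
    proof -
      have "vec.span (range embed) \<subseteq> {s. split_okubo_mult (embed x) s = split_okubo_mult s (embed x)}"
      proof (rule vec.span_minimal)
        show "range embed \<subseteq> {s. split_okubo_mult (embed x) s = split_okubo_mult s (embed x)}"
          using commute by (auto simp flip: embed_mult)
        show "vec.subspace {s. split_okubo_mult (embed x) s = split_okubo_mult s (embed x)}"
          using split_mult_scale_left[of 0 0 "embed x"] split_mult_scale_right[of "embed x" 0 0]
          by (auto simp: vec.subspace_def split_mult_add_left split_mult_add_right
              split_mult_scale_left split_mult_scale_right)
      qed
      then show ?thesis unfolding span_range_embed by blast
    qed
    then show "x = 0" by (intro embed_eq_zero split_commuting_eq_zero)
  qed
  then show ?thesis ..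
qed

end

lemma (in okubo_algebra) eight_dim_symmetric_composition:
  "\<exists>n Basis. eight_dim_symmetric_composition scale mult n Basis"
proof -
  obtain \<phi> where "split_extension scale mult \<phi>"
    using extension_iso_split nonassoc_algebra_axioms
    unfolding split_extension_def split_extension_axioms_def by blast
  then show ?thesis using split_extension.eight_dim by blast
qed

section \<open>The length of an Okubo algebra\<close>

context eight_dim_symmetric_composition
begin

text \<open>A zero divisor is isotropic because \<open>(x \<star> y) \<star> x = n x \<cdot> y\<close>, so that the only other case
  is an idempotent in an anisotropic algebra.\<close>

lemma algebra_length_four_if_idempotent_or_zero_divisor:
  assumes "has_nonzero_idempotent \<or> has_zero_divisor"
  shows "algebra_length = 4"
proof (cases "\<exists>x. x \<noteq> 0 \<and> n x = 0")
  case True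
  then show ?thesis using algebra_length_isotropic by blast
next
  case False
  have "\<not> zero_divisor a" for a
  proof
    assume "zero_divisor a"
    then obtain b where "a \<noteq> 0" "b \<noteq> 0" "a \<star> b = 0 \<or> b \<star> a = 0"
      by (auto simp: zero_divisor_def)
    then have "n a \<cdot> b = 0" using comp_left[of a b] comp_right[of a b] by auto
    then show False using False \<open>a \<noteq> 0\<close> \<open>b \<noteq> 0\<close> by auto
  qed
  then obtain e where "e \<noteq> 0" "e \<star> e = e"
    using assms by (auto simp: has_zero_divisor_def has_nonzero_idempotent_def)
  then interpret anisotropic_with_idempotent scale mult n Basis e
    by unfold_locales (use False in auto)
  show ?thesis by (rule algebra_length_anisotropic)
qed

end

theorem theorem4p15:
  fixes scale :: "'a::field \<Rightarrow> 'v::ab_group_add \<Rightarrow> 'v"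
    and mult :: "'v \<Rightarrow> 'v \<Rightarrow> 'v"
  assumes "okubo_algebra scale mult"
    and "nonassoc_algebra.has_nonzero_idempotent mult \<or> nonassoc_algebra.has_zero_divisor mult"
  shows "nonassoc_algebra.algebra_length scale mult = 4"
proof -
  obtain n Basis where "eight_dim_symmetric_composition scale mult n Basis"
    using okubo_algebra.eight_dim_symmetric_composition[OF assms(1)] by blast
  then show ?thesis
    using eight_dim_symmetric_composition.algebra_length_four_if_idempotent_or_zero_divisor assms(2)
    by blast
qed

end
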